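(* Let $\mathcal E$ be a nonlinear order preserving form on $L^2(\mu)$. Assume that either $(M(\mathcal E),\|\cdot\|_L)$ is a Banach space, or that $\mathcal E_e$ exists and $\mathcal E$ is reflexive and subcritical. Then: (a) Let $g\in L^0(\mu)$ and $A\subseteq X$ measurable such that there exists $f\in D(\mathcal E_e)$ with $f\ge g$ a.e. on $A$. Then there exists an $\mathcal E$-excessive function $0\le h\in D(\mathcal E_e)$ with $h\ge g$ a.e. on $A$ and $\mathcal E_e(h)=\min\{\mathcal E_e(f): f\in L^0(\mu),\ f\ge g\text{ on }A\}$. If $\mathcal E_e$ is strictly convex, then $h$ is unique. Moreover, if $(M(\mathcal E),\|\cdot\|_L)$ is a Banach space, then $\mathcal E=\mathcal E_e$ and $h\in D(\mathcal E)$. (b) If there exists $g\in D(\mathcal E_e)$ with $g>0$ a.e., then there exists an $\mathcal E$-excessive function $h\colon X\to(0,\infty)$.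
   Context: $(X,\mathfrak A,\mu)$ is $\sigma$-finite; $L^0(\mu)$ carries local convergence in measure. A nonlinear order preserving form is a lower semicontinuous convex $\mathcal E\colon L^2(\mu)\to[0,\infty]$ with $\mathcal E(-f)=\mathcal E(f)$, $\mathcal E(0)=0$ and $\mathcal E(f+|g|)+\mathcal E(f-|g|)\le\mathcal E(f+g)+\mathcal E(f-g)$ for all $f,g$. $M(\mathcal E)=\{f:\lim_{\lambda\to0+}\mathcal E(\lambda f)=0\}$, $\|f\|_L=\inf\{\lambda>0:\mathcal E(\lambda^{-1}f)\le1\}$; reflexive means the image of $M(\mathcal E)$ in the bidual of $(M(\mathcal E),\|\cdot\|_L)$ is norm dense. $\mathcal E_e$ exists if $\mathcal E$ (extended by $+\infty$ to $L^0$) is lower semicontinuous on $D(\mathcal E)$ w.r.t. local convergence in measure; $\mathcal E_e$ is then its lower semicontinuous relaxation on $L^0(\mu)$. $\mathcal E_e$ is strictly convex if $\mathcal E_e((f+g)/2)<(\mathcal E_e(f)+\mathcal E_e(g))/2$ for $f\neq g$ in $D(\mathcal E_e)$. Resolvent $G_\alpha f$ minimizes $g\mapsto\mathcal E(g)+\frac\alpha2\|g-\alpha^{-1}f\|_2^2$, extended to nonnegative measurable functions by monotone limits; $Gf=\lim_{\alpha\to0+}G_\alpha f$. Subcritical: there is measurable $f\colon X\to(0,\infty)$ with $Gf<\infty$ a.e. A measurable $h\colon X\to[0,\infty)$ is $\mathcal E$-excessive if $G_\alpha(\alpha h)\le h$ for all $\alpha>0$. *)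

theory Defs
  imports "HOL-Analysis.Analysis" "HOL-Probability.Probability"
begin

section \<open>Function spaces (functions represent a.e.-classes)\<close>

definition L0 :: "'a measure \<Rightarrow> ('a \<Rightarrow> real) set" where
  "L0 M = borel_measurable M"

definition L2 :: "'a measure \<Rightarrow> ('a \<Rightarrow> real) set" where
  "L2 M = {f. f \<in> borel_measurable M \<and> integrable M (\<lambda>x. (f x)\<^sup>2)}"

definition l2sq :: "'a measure \<Rightarrow> ('a \<Rightarrow> real) \<Rightarrow> ('a \<Rightarrow> real) \<Rightarrow> real" where
  "l2sq M f g = (\<integral>x. (f x - g x)\<^sup>2 \<partial>M)"

text \<open>Local convergence in measure (sequential; the topology is metrizable for sigma-finite M).\<close>
definition loc_meas_conv :: "'a measure \<Rightarrow> (nat \<Rightarrow> 'a \<Rightarrow> real) \<Rightarrow> ('a \<Rightarrow> real) \<Rightarrow> bool" where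
  "loc_meas_conv M fs f \<longleftrightarrow>
     (\<forall>A\<in>sets M. emeasure M A < \<infinity> \<longrightarrow>
        (\<forall>e>0. ((\<lambda>n. emeasure M {x\<in>A. e < \<bar>fs n x - f x\<bar>}) \<longlongrightarrow> 0) sequentially))"

text \<open>The form E is a functional on L2(mu); its values on functions outside L2 are irrelevant.\<close>
definition Ebar :: "'a measure \<Rightarrow> (('a \<Rightarrow> real) \<Rightarrow> ennreal) \<Rightarrow> ('a \<Rightarrow> real) \<Rightarrow> ennreal" where
  "Ebar M E f = (if f \<in> L2 M then E f else \<infinity>)"

definition nonlinear_order_preserving_form ::
  "'a measure \<Rightarrow> (('a \<Rightarrow> real) \<Rightarrow> ennreal) \<Rightarrow> bool" where
  "nonlinear_order_preserving_form M E \<longleftrightarrow>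
     \<comment> \<open>well defined on a.e.-classes\<close>
     (\<forall>f\<in>L2 M. \<forall>g\<in>L2 M. (AE x in M. f x = g x) \<longrightarrow> E f = E g) \<and>
     \<comment> \<open>lower semicontinuous on L2\<close>
     (\<forall>fs f. (\<forall>n. fs n \<in> L2 M) \<longrightarrow> f \<in> L2 M \<longrightarrow>
        ((\<lambda>n. l2sq M (fs n) f) \<longlonglongrightarrow> 0) \<longrightarrow> E f \<le> liminf (\<lambda>n. E (fs n))) \<and>
     \<comment> \<open>convex\<close>
     (\<forall>f\<in>L2 M. \<forall>g\<in>L2 M. \<forall>t::real. 0 < t \<and> t < 1 \<longrightarrow>
        E (\<lambda>x. t * f x + (1 - t) * g x) \<le> ennreal t * E f + ennreal (1 - t) * E g) \<and>
     (\<forall>f\<in>L2 M. E (\<lambda>x. - f x) = E f) \<and>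
     E (\<lambda>x. 0) = 0 \<and>
     (\<forall>f\<in>L2 M. \<forall>g\<in>L2 M.
        E (\<lambda>x. f x + \<bar>g x\<bar>) + E (\<lambda>x. f x - \<bar>g x\<bar>) \<le> E (\<lambda>x. f x + g x) + E (\<lambda>x. f x - g x))"

definition ME :: "'a measure \<Rightarrow> (('a \<Rightarrow> real) \<Rightarrow> ennreal) \<Rightarrow> ('a \<Rightarrow> real) set" where
  "ME M E = {f\<in>L2 M. ((\<lambda>l::real. E (\<lambda>x. l * f x)) \<longlongrightarrow> 0) (at_right 0)}"

definition lux_norm :: "(('a \<Rightarrow> real) \<Rightarrow> ennreal) \<Rightarrow> ('a \<Rightarrow> real) \<Rightarrow> real" where
  "lux_norm E f = Inf {l::real. l > 0 \<and> E (\<lambda>x. f x / l) \<le> 1}"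

definition lux_banach :: "'a measure \<Rightarrow> (('a \<Rightarrow> real) \<Rightarrow> ennreal) \<Rightarrow> bool" where
  "lux_banach M E \<longleftrightarrow>
     (\<forall>f\<in>ME M E. lux_norm E f = 0 \<longrightarrow> (AE x in M. f x = 0)) \<and>
     (\<forall>fs. (\<forall>n. fs n \<in> ME M E) \<longrightarrow>
        (\<forall>e>0. \<exists>N. \<forall>m\<ge>N. \<forall>n\<ge>N. lux_norm E (\<lambda>x. fs m x - fs n x) < e) \<longrightarrow>
        (\<exists>f\<in>ME M E. (\<lambda>n. lux_norm E (\<lambda>x. fs n x - f x)) \<longlonglongrightarrow> 0))"

definition ME_dual :: "'a measure \<Rightarrow> (('a \<Rightarrow> real) \<Rightarrow> ennreal) \<Rightarrow> (('a \<Rightarrow> real) \<Rightarrow> real) set" where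
  "ME_dual M E = {\<phi>. (\<forall>f\<in>ME M E. \<forall>g\<in>ME M E. \<forall>a b::real.
        \<phi> (\<lambda>x. a * f x + b * g x) = a * \<phi> f + b * \<phi> g) \<and>
      (\<exists>C. \<forall>f\<in>ME M E. \<bar>\<phi> f\<bar> \<le> C * lux_norm E f)}"

definition dual_norm :: "'a measure \<Rightarrow> (('a \<Rightarrow> real) \<Rightarrow> ennreal) \<Rightarrow> (('a \<Rightarrow> real) \<Rightarrow> real) \<Rightarrow> real" where
  "dual_norm M E \<phi> = Sup {\<bar>\<phi> f\<bar> | f. f \<in> ME M E \<and> lux_norm E f \<le> 1}"

definition ME_bidual :: "'a measure \<Rightarrow> (('a \<Rightarrow> real) \<Rightarrow> ennreal) \<Rightarrow> ((('a \<Rightarrow> real) \<Rightarrow> real) \<Rightarrow> real) set" where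
  "ME_bidual M E = {\<Phi>. (\<forall>\<phi>\<in>ME_dual M E. \<forall>\<psi>\<in>ME_dual M E. \<forall>a b::real.
        \<Phi> (\<lambda>f. a * \<phi> f + b * \<psi> f) = a * \<Phi> \<phi> + b * \<Phi> \<psi>) \<and>
      (\<exists>C. \<forall>\<phi>\<in>ME_dual M E. \<bar>\<Phi> \<phi>\<bar> \<le> C * dual_norm M E \<phi>)}"

definition reflexive_form :: "'a measure \<Rightarrow> (('a \<Rightarrow> real) \<Rightarrow> ennreal) \<Rightarrow> bool" where
  "reflexive_form M E \<longleftrightarrow>
     (\<forall>\<Phi>\<in>ME_bidual M E. \<forall>e>0. \<exists>f\<in>ME M E.
        Sup {\<bar>\<Phi> \<phi> - \<phi> f\<bar> | \<phi>. \<phi> \<in> ME_dual M E \<and> dual_norm M E \<phi> \<le> 1} < e)"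

definition Ee_exists :: "'a measure \<Rightarrow> (('a \<Rightarrow> real) \<Rightarrow> ennreal) \<Rightarrow> bool" where
  "Ee_exists M E \<longleftrightarrow>
     (\<forall>fs f. (\<forall>n. fs n \<in> L2 M \<and> E (fs n) < \<infinity>) \<longrightarrow> f \<in> L2 M \<longrightarrow> E f < \<infinity> \<longrightarrow>
        loc_meas_conv M fs f \<longrightarrow> E f \<le> liminf (\<lambda>n. E (fs n)))"

text \<open>Lower semicontinuous relaxation on L0 of E extended by infinity (sequential form,
  the local convergence in measure topology being metrizable).\<close>
definition Ee :: "'a measure \<Rightarrow> (('a \<Rightarrow> real) \<Rightarrow> ennreal) \<Rightarrow> ('a \<Rightarrow> real) \<Rightarrow> ennreal" where
  "Ee M E f = Inf {liminf (\<lambda>n. Ebar M E (fs n)) | fs. (\<forall>n. fs n \<in> L0 M) \<and> loc_meas_conv M fs f}"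

definition DEe :: "'a measure \<Rightarrow> (('a \<Rightarrow> real) \<Rightarrow> ennreal) \<Rightarrow> ('a \<Rightarrow> real) set" where
  "DEe M E = {f\<in>L0 M. Ee M E f < \<infinity>}"

definition Ee_strictly_convex :: "'a measure \<Rightarrow> (('a \<Rightarrow> real) \<Rightarrow> ennreal) \<Rightarrow> bool" where
  "Ee_strictly_convex M E \<longleftrightarrow>
     (\<forall>f\<in>DEe M E. \<forall>g\<in>DEe M E. \<not> (AE x in M. f x = g x) \<longrightarrow>
        Ee M E (\<lambda>x. (f x + g x) / 2) < (Ee M E f + Ee M E g) / 2)"

text \<open>Resolvent on L2: a minimizer (unique a.e.) of g \<mapsto> E g + alpha/2 * norm (g - f/alpha)^2.\<close>
definition resolvent :: "'a measure \<Rightarrow> (('a \<Rightarrow> real) \<Rightarrow> ennreal) \<Rightarrow> real \<Rightarrow> ('a \<Rightarrow> real) \<Rightarrow> ('a \<Rightarrow> real)" where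
  "resolvent M E \<alpha> f = (SOME g. g \<in> L2 M \<and>
     (\<forall>k\<in>L2 M. E g + ennreal (\<alpha> / 2 * l2sq M g (\<lambda>x. f x / \<alpha>))
               \<le> E k + ennreal (\<alpha> / 2 * l2sq M k (\<lambda>x. f x / \<alpha>))))"

definition resolvent_ext :: "'a measure \<Rightarrow> (('a \<Rightarrow> real) \<Rightarrow> ennreal) \<Rightarrow> real \<Rightarrow> ('a \<Rightarrow> real) \<Rightarrow> ('a \<Rightarrow> ennreal)" where
  "resolvent_ext M E \<alpha> f = (SOME v. \<exists>us.
     (\<forall>n. us n \<in> L2 M \<and> (\<forall>x. 0 \<le> us n x)) \<and>
     (\<forall>x. incseq (\<lambda>n. us n x)) \<and> (\<forall>x. (\<lambda>n. us n x) \<longlonglongrightarrow> f x) \<and>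
     (AE x in M. (\<lambda>n. ennreal (resolvent M E \<alpha> (us n) x)) \<longlonglongrightarrow> v x))"

text \<open>Subcritical: some measurable f > 0 has G f = lim_{alpha \<rightarrow> 0+} G_alpha f finite a.e.
  (the limit is taken along alpha = 1/(n+1)).\<close>
definition subcritical :: "'a measure \<Rightarrow> (('a \<Rightarrow> real) \<Rightarrow> ennreal) \<Rightarrow> bool" where
  "subcritical M E \<longleftrightarrow> (\<exists>f\<in>borel_measurable M. (\<forall>x. 0 < f x) \<and>
     (AE x in M. \<exists>L. L < \<infinity> \<and>
        (\<lambda>n. resolvent_ext M E (1 / real (Suc n)) f x) \<longlonglongrightarrow> L))"

definition excessive :: "'a measure \<Rightarrow> (('a \<Rightarrow> real) \<Rightarrow> ennreal) \<Rightarrow> ('a \<Rightarrow> real) \<Rightarrow> bool" where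
  "excessive M E h \<longleftrightarrow> h \<in> borel_measurable M \<and> (\<forall>x. 0 \<le> h x) \<and>
     (\<forall>\<alpha>>0. AE x in M. resolvent_ext M E \<alpha> (\<lambda>y. \<alpha> * h y) x \<le> ennreal (h x))"

end

theory Submission
  imports Defs
begin

text \<open>
  The only compactness needed is that nonnegative functions of bounded energy are bounded almost
  everywhere along a subsequence. Given this, convex combinations of a minimising sequence, chosen
  so that they almost minimise \<open>f \<mapsto> \<integral> p exp(-f)\<close>, converge almost everywhere to a finite limit,
  which is a minimiser by convexity and the definition of \<open>\<E>\<^sub>e\<close> as a relaxation. A nonnegative
  minimiser \<open>h\<close> is excessive: if \<open>w = G\<^sub>\<alpha> u\<close> with \<open>u \<le> \<alpha> h\<close>, then \<open>w \<and> h\<close> has at most the energy of \<open>w\<close>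
  (since \<open>w \<or> h\<close> competes with \<open>h\<close>) and is closer to \<open>u / \<alpha>\<close>, so \<open>w \<le> h\<close>.

  In the subcritical case the compactness comes from testing minimality of \<open>G\<^sub>\<alpha> u\<close> against \<open>\<phi>\<close>, which
  gives \<open>\<langle>u, \<phi>\<rangle> \<le> \<E>(\<phi>) + \<alpha>/2 \<parallel>\<phi>\<parallel>\<^sup>2 + \<langle>u, G\<^sub>\<alpha> u\<rangle>\<close>; let \<open>\<alpha> \<rightarrow> 0\<close> with a weight \<open>u > 0\<close> such that
  \<open>\<langle>u, G u\<rangle> < \<infinity>\<close>. In the Banach case a nested-ball argument shows that the \<open>L\<^sup>2\<close>-norm is dominated by the
  Luxemburg norm; bounded energy then means bounded in \<open>L\<^sup>2\<close>, which also yields \<open>\<E> = \<E>\<^sub>e\<close>.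
\<close>

section \<open>The space L2\<close>

text \<open>The obstacle is that a minimising sequence for \<open>Ee\<close> lives in a space of
  measurable functions that need not be locally convex, so weak limits and Mazur's lemma are not at
  hand. What survives is convexity. Almost minimisers of a functional J over shrinking tail hulls
  have small midpoint defect, and they are Cauchy as soon as this defect controls an L2 distance.
  For the squared norm the defect is a quarter of the squared distance. For the integral of p
  exp(-f) it is half the squared distance of sqrt(p) exp(-f/2), and since exp(-f) \<le> 1 for f
  \<ge> 0, no integrability of f is required.

  Neither convexity nor lower semicontinuity of \<open>Ee\<close> is established. A function of
  finite extended energy is replaced by a recovery sequence in L2, the axioms of \<open>E\<close>
  are applied there, and \<open>Ee\<close> of the limit is bounded by the limes inferior. Since
  energies are \<open>ennreal\<close> values, every cancellation in a comparison of energies first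
  secures a finite term: comparison with the zero function does this for resolvents, and finiteness
  of the minimum does it for minimisers.\<close>

lemma L2_measurable [measurable_dest]: "f \<in> L2 M \<Longrightarrow> f \<in> borel_measurable M"
  by (simp add: L2_def)

lemma L2_integrable_square: "f \<in> L2 M \<Longrightarrow> integrable M (\<lambda>x. (f x)\<^sup>2)"
  by (simp add: L2_def)

lemma L2_dominated:
  assumes g: "g \<in> L2 M" and f: "f \<in> borel_measurable M"
    and le: "AE x in M. \<bar>f x\<bar> \<le> \<bar>g x\<bar>"
  shows "f \<in> L2 M"
proof -
  have "AE x in M. norm ((f x)\<^sup>2) \<le> norm ((g x)\<^sup>2)"
    using le by eventually_elim (simp add: abs_le_square_iff)
  moreover have "(\<lambda>x. (f x)\<^sup>2) \<in> borel_measurable M"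
    using f by simp
  ultimately have "integrable M (\<lambda>x. (f x)\<^sup>2)"
    using Bochner_Integration.integrable_bound[OF L2_integrable_square[OF g]] by blast
  then show ?thesis using f by (simp add: L2_def)
qed

lemma L2_cmult: "f \<in> L2 M \<Longrightarrow> (\<lambda>x. c * f x) \<in> L2 M"
  by (auto simp: L2_def power_mult_distrib)

lemma L2_add:
  assumes f: "f \<in> L2 M" and g: "g \<in> L2 M"
  shows "(\<lambda>x. f x + g x) \<in> L2 M"
proof -
  have i: "integrable M (\<lambda>x. 2 * (f x)\<^sup>2 + 2 * (g x)\<^sup>2)"
    using L2_integrable_square[OF f] L2_integrable_square[OF g] by simp
  have "(f x + g x)\<^sup>2 \<le> 2 * (f x)\<^sup>2 + 2 * (g x)\<^sup>2" for x
    using sum_squares_bound[of "f x" "g x"] by (simp add: power2_sum)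
  then have le: "norm ((f x + g x)\<^sup>2) \<le> norm (2 * (f x)\<^sup>2 + 2 * (g x)\<^sup>2)" for x
    by simp
  have m: "(\<lambda>x. f x + g x) \<in> borel_measurable M"
    using L2_measurable[OF f] L2_measurable[OF g] by simp
  have "integrable M (\<lambda>x. (f x + g x)\<^sup>2)"
    by (rule Bochner_Integration.integrable_bound[OF i _ AE_I2[OF le]])
      (rule borel_measurable_power[OF m])
  with m show ?thesis by (simp add: L2_def)
qed

lemma L2_zero [simp]: "(\<lambda>x. 0) \<in> L2 M"
  by (simp add: L2_def)

lemma L2_uminus: "f \<in> L2 M \<Longrightarrow> (\<lambda>x. - f x) \<in> L2 M"
  by (auto simp: L2_def)

lemma L2_diff: "f \<in> L2 M \<Longrightarrow> g \<in> L2 M \<Longrightarrow> (\<lambda>x. f x - g x) \<in> L2 M"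
  using L2_add[OF _ L2_uminus] by force

lemma L2_divide: "f \<in> L2 M \<Longrightarrow> (\<lambda>x. f x / c) \<in> L2 M"
  using L2_cmult[of f M "inverse c"] by (simp add: divide_inverse mult.commute)

lemma L2_abs: "f \<in> L2 M \<Longrightarrow> (\<lambda>x. \<bar>f x\<bar>) \<in> L2 M"
  by (auto simp: L2_def)

lemma L2_mid: "f \<in> L2 M \<Longrightarrow> g \<in> L2 M \<Longrightarrow> (\<lambda>x. (f x + g x) / 2) \<in> L2 M"
  by (intro L2_divide L2_add)

lemma L2_max:
  assumes "f \<in> L2 M" "g \<in> L2 M"
  shows "(\<lambda>x. max (f x) (g x)) \<in> L2 M"
proof (rule L2_dominated)
  show "(\<lambda>x. \<bar>f x\<bar> + \<bar>g x\<bar>) \<in> L2 M"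
    using assms by (intro L2_add L2_abs)
  show "(\<lambda>x. max (f x) (g x)) \<in> borel_measurable M"
    using assms[THEN L2_measurable] by simp
qed auto

lemma L2_min:
  assumes "f \<in> L2 M" "g \<in> L2 M"
  shows "(\<lambda>x. min (f x) (g x)) \<in> L2 M"
proof (rule L2_dominated)
  show "(\<lambda>x. \<bar>f x\<bar> + \<bar>g x\<bar>) \<in> L2 M"
    using assms by (intro L2_add L2_abs)
  show "(\<lambda>x. min (f x) (g x)) \<in> borel_measurable M"
    using assms[THEN L2_measurable] by simp
qed auto

lemmas L2_intros = L2_cmult L2_add L2_zero L2_uminus L2_diff L2_divide L2_abs L2_max L2_min

lemma L2_integrable_mult:
  assumes f: "f \<in> L2 M" and g: "g \<in> L2 M"
  shows "integrable M (\<lambda>x. f x * g x)"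
proof -
  have "integrable M (\<lambda>x. ((f x + g x)\<^sup>2 - (f x)\<^sup>2 - (g x)\<^sup>2) / 2)"
    using L2_integrable_square[OF L2_add[OF f g]] L2_integrable_square[OF f]
      L2_integrable_square[OF g] by simp
  moreover have "(\<lambda>x. ((f x + g x)\<^sup>2 - (f x)\<^sup>2 - (g x)\<^sup>2) / 2) = (\<lambda>x. f x * g x)"
    by (simp add: power2_eq_square algebra_simps)
  ultimately show ?thesis by simp
qed

section \<open>The squared L2 distance and its convergence properties\<close>

lemma l2sq_integrable: "f \<in> L2 M \<Longrightarrow> g \<in> L2 M \<Longrightarrow> integrable M (\<lambda>x. (f x - g x)\<^sup>2)"
  using L2_integrable_square[OF L2_diff] .

lemma l2sq_nonneg [simp]: "0 \<le> l2sq M f g"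
  by (simp add: l2sq_def)

lemma l2sq_nn_integral:
  "f \<in> L2 M \<Longrightarrow> g \<in> L2 M \<Longrightarrow> (\<integral>\<^sup>+x. ennreal ((f x - g x)\<^sup>2) \<partial>M) = ennreal (l2sq M f g)"
  unfolding l2sq_def using l2sq_integrable by (intro nn_integral_eq_integral) auto

lemma l2sq_cong_AE:
  assumes "f \<in> borel_measurable M" "f' \<in> borel_measurable M" "g \<in> borel_measurable M"
    and "AE x in M. f x = f' x"
  shows "l2sq M f g = l2sq M f' g"
  unfolding l2sq_def using assms by (intro integral_cong_AE) auto

text \<open>Strict convexity of the squared norm in exact form: the gap at the midpoint is a quarter
  of the squared distance. It later yields both uniqueness of minimisers and Cauchy sequences of
  almost minimisers.\<close>

lemma l2sq_parallelogram:
  assumes f: "f \<in> L2 M" and g: "g \<in> L2 M" and u: "u \<in> L2 M"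
  shows "(l2sq M f u + l2sq M g u) / 2 = l2sq M (\<lambda>x. (f x + g x) / 2) u + l2sq M f g / 4"
proof -
  note i = l2sq_integrable
  have "(l2sq M f u + l2sq M g u) / 2 = (\<integral>x. ((f x - u x)\<^sup>2 + (g x - u x)\<^sup>2) / 2 \<partial>M)"
    unfolding l2sq_def using i[OF f u] i[OF g u] by simp
  also have "\<dots> = (\<integral>x. ((f x + g x) / 2 - u x)\<^sup>2 + (f x - g x)\<^sup>2 / 4 \<partial>M)"
    by (rule Bochner_Integration.integral_cong) (auto simp: power2_eq_square field_simps)
  also have "\<dots> = l2sq M (\<lambda>x. (f x + g x) / 2) u + l2sq M f g / 4"
    unfolding l2sq_def using i[OF L2_mid[OF f g] u] i[OF f g] by simp
  finally show ?thesis .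
qed

lemma l2sq_eq_0:
  assumes "f \<in> L2 M" "g \<in> L2 M" "l2sq M f g = 0"
  shows "AE x in M. f x = g x"
proof -
  have "AE x in M. (f x - g x)\<^sup>2 = 0"
    using assms l2sq_integrable[of f M g] integral_nonneg_eq_0_iff_AE[of M "\<lambda>x. (f x - g x)\<^sup>2"]
    unfolding l2sq_def by auto
  then show ?thesis by eventually_elim simp
qed

lemma l2sq_dominated_convergence:
  assumes g: "g \<in> L2 M" and fn: "\<And>n. fn n \<in> borel_measurable M" and f: "f \<in> borel_measurable M"
    and dom: "\<And>n. AE x in M. \<bar>fn n x\<bar> \<le> g x"
    and lim: "AE x in M. (\<lambda>n. fn n x) \<longlonglongrightarrow> f x"
  shows "f \<in> L2 M" "(\<lambda>n. l2sq M (fn n) f) \<longlonglongrightarrow> 0"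
proof -
  have "AE x in M. \<forall>n. \<bar>fn n x\<bar> \<le> g x"
    using dom by (simp add: AE_all_countable)
  with lim have bd: "AE x in M. \<bar>f x\<bar> \<le> g x"
  proof eventually_elim
    case (elim x)
    then show ?case by (intro LIMSEQ_le_const2[OF tendsto_rabs[of "\<lambda>n. fn n x"]]) auto
  qed
  then show fL: "f \<in> L2 M"
    by (intro L2_dominated[OF g f]) (auto elim: eventually_mono)
  have "(\<lambda>n. \<integral>x. (fn n x - f x)\<^sup>2 \<partial>M) \<longlonglongrightarrow> (\<integral>x. 0 \<partial>M)"
  proof (rule integral_dominated_convergence)
    show "integrable M (\<lambda>x. (2 * g x)\<^sup>2)"
      by (rule L2_integrable_square[OF L2_cmult[OF g]])
    show "AE x in M. (\<lambda>n. (fn n x - f x)\<^sup>2) \<longlonglongrightarrow> 0"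
      using lim
    proof eventually_elim
      case (elim x)
      then have "(\<lambda>n. (fn n x - f x)\<^sup>2) \<longlonglongrightarrow> (f x - f x)\<^sup>2"
        by (intro tendsto_intros)
      then show ?case by simp
    qed
    show "AE x in M. norm ((fn n x - f x)\<^sup>2) \<le> (2 * g x)\<^sup>2" for n
      using bd dom[of n]
    proof eventually_elim
      case (elim x)
      then have "\<bar>fn n x - f x\<bar> \<le> \<bar>2 * g x\<bar>" by linarith
      then show ?case by (simp only: abs_le_square_iff real_norm_def abs_power2)
    qed
  qed (use fn f in auto)
  then show "(\<lambda>n. l2sq M (fn n) f) \<longlonglongrightarrow> 0" by (simp add: l2sq_def)
qed

lemma l2sq_tendsto:
  assumes fn: "\<And>n. fn n \<in> L2 M" and f: "f \<in> L2 M" and u: "u \<in> L2 M"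
    and lim: "(\<lambda>n. l2sq M (fn n) f) \<longlonglongrightarrow> 0"
  shows "(\<lambda>n. l2sq M (fn n) u) \<longlonglongrightarrow> l2sq M f u"
proof -
  text \<open>Young's inequality with parameter \<open>t\<close> replaces the triangle inequality for the norm.\<close>
  have young: "\<bar>l2sq M (fn n) u - l2sq M f u\<bar> \<le> (1 + 1 / t) * l2sq M (fn n) f + t * l2sq M f u"
    if t: "t > 0" for t n
  proof -
    have ab: "\<bar>2 * a * b\<bar> \<le> (1 / t) * a\<^sup>2 + t * b\<^sup>2" for a b :: real
    proof -
      have "\<bar>2 * a * b\<bar> = 2 * (\<bar>a\<bar> / sqrt t) * (sqrt t * \<bar>b\<bar>)"
        using t by (simp add: abs_mult)
      also have "\<dots> \<le> (\<bar>a\<bar> / sqrt t)\<^sup>2 + (sqrt t * \<bar>b\<bar>)\<^sup>2"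
        by (rule sum_squares_bound)
      also have "\<dots> = (1 / t) * a\<^sup>2 + t * b\<^sup>2"
        using t by (simp add: power_mult_distrib power_divide)
      finally show ?thesis .
    qed
    have pt: "\<bar>(fn n x - u x)\<^sup>2 - (f x - u x)\<^sup>2\<bar>
        \<le> (1 + 1 / t) * (fn n x - f x)\<^sup>2 + t * (f x - u x)\<^sup>2" for x
    proof -
      have "(fn n x - u x)\<^sup>2 - (f x - u x)\<^sup>2
          = (fn n x - f x)\<^sup>2 + 2 * (fn n x - f x) * (f x - u x)"
        by (simp add: power2_eq_square algebra_simps)
      with ab[of "fn n x - f x" "f x - u x"] show ?thesis
        by (simp add: distrib_right) (smt (verit) zero_le_power2)
    qed
    note i = l2sq_integrable[OF fn[of n] f] l2sq_integrable[OF f u] l2sq_integrable[OF fn[of n] u]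
    have "\<bar>l2sq M (fn n) u - l2sq M f u\<bar> = \<bar>\<integral>x. (fn n x - u x)\<^sup>2 - (f x - u x)\<^sup>2 \<partial>M\<bar>"
      unfolding l2sq_def using i by simp
    also have "\<dots> \<le> (\<integral>x. \<bar>(fn n x - u x)\<^sup>2 - (f x - u x)\<^sup>2\<bar> \<partial>M)"
      by (rule integral_abs_bound)
    also have "\<dots> \<le> (\<integral>x. (1 + 1 / t) * (fn n x - f x)\<^sup>2 + t * (f x - u x)\<^sup>2 \<partial>M)"
      using i pt by (intro integral_mono) auto
    also have "\<dots> = (1 + 1 / t) * l2sq M (fn n) f + t * l2sq M f u"
      unfolding l2sq_def using i by simp
    finally show ?thesis .
  qed
  show ?thesis
  proof (rule LIMSEQ_I)
    fix e :: real assume e: "e > 0"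
    \<comment> \<open>The term \<open>t * l2sq M f u\<close> has to be below e / 2; the added 1
      keeps the denominator positive when \<open>l2sq M f u\<close> is 0.\<close>
    define t where "t = e / (2 * (l2sq M f u + 1))"
    have pos: "l2sq M f u + 1 > 0"
      using l2sq_nonneg[of M f u] by linarith
    have t: "t > 0" using e pos by (simp add: t_def)
    have tb: "t * l2sq M f u < e / 2"
    proof -
      have "t * l2sq M f u < t * (l2sq M f u + 1)" using t by simp
      also have "\<dots> = e / 2" using pos by (simp add: t_def field_simps)
      finally show ?thesis .
    qed
    have "(\<lambda>n. (1 + 1 / t) * l2sq M (fn n) f) \<longlonglongrightarrow> (1 + 1 / t) * 0"
      by (intro tendsto_mult tendsto_const lim)
    then have "\<forall>\<^sub>F n in sequentially. (1 + 1 / t) * l2sq M (fn n) f < e / 2"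
      using e by (intro order_tendstoD(2)) auto
    then obtain N where N: "\<And>n. n \<ge> N \<Longrightarrow> (1 + 1 / t) * l2sq M (fn n) f < e / 2"
      by (auto simp: eventually_sequentially)
    show "\<exists>N. \<forall>n\<ge>N. norm (l2sq M (fn n) u - l2sq M f u) < e"
    proof (intro exI allI impI)
      fix n assume "n \<ge> N"
      have "norm (l2sq M (fn n) u - l2sq M f u) \<le> (1 + 1 / t) * l2sq M (fn n) f + t * l2sq M f u"
        using young[OF t, of n] by simp
      also have "\<dots> < e / 2 + e / 2"
        by (intro add_strict_mono N tb) fact
      finally show "norm (l2sq M (fn n) u - l2sq M f u) < e" by simp
    qed
  qed
qed

text \<open>The subsequence argument of Riesz and Fischer. Stating it with nonnegative integrals of
  differences lets it serve for any measurable sequence, without membership in L2.\<close>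

lemma square_Cauchy_AE_subseq:
  fixes f :: "nat \<Rightarrow> 'a \<Rightarrow> real"
  assumes [measurable]: "\<And>n. f n \<in> borel_measurable M"
    and cauchy: "\<And>e::real. e > 0 \<Longrightarrow> \<exists>N. \<forall>m\<ge>N. \<forall>n\<ge>N. (\<integral>\<^sup>+x. ennreal ((f m x - f n x)\<^sup>2) \<partial>M) \<le> ennreal e"
  obtains r :: "nat \<Rightarrow> nat" where "strict_mono r" "AE x in M. convergent (\<lambda>n. f (r n) x)"
proof -
  have "\<exists>N. \<forall>m\<ge>N. \<forall>n\<ge>N. (\<integral>\<^sup>+x. ennreal ((f m x - f n x)\<^sup>2) \<partial>M) \<le> ennreal ((1/8)^k)" for k
    by (rule cauchy) simp
  then obtain K where K: "\<And>k m n. m \<ge> K k \<Longrightarrow> n \<ge> K k \<Longrightarrow>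
      (\<integral>\<^sup>+x. ennreal ((f m x - f n x)\<^sup>2) \<partial>M) \<le> ennreal ((1/8)^k)"
    by metis
  \<comment> \<open>The summand n makes \<open>r\<close> strictly increasing; the partial sum gives
    \<open>r n \<ge> K n\<close> although \<open>K\<close> need not be monotone.\<close>
  define r where "r n = n + (\<Sum>i\<le>n. K i)" for n
  have r: "strict_mono r"
    by (rule strict_monoI_Suc) (simp add: r_def)
  have rK: "r n \<ge> K n" for n
  proof -
    have "K n \<le> (\<Sum>i\<le>n. K i)" by (rule member_le_sum) auto
    then show ?thesis by (simp add: r_def)
  qed
  have rK': "r (Suc n) \<ge> K n" for n
    using rK[of n] strict_mono_less_eq[OF r, of n "Suc n"] by linarith
  define d where "d n x = f (r (Suc n)) x - f (r n) x" for n x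
  have [measurable]: "d n \<in> borel_measurable M" for n
    unfolding d_def by measurable
  \<comment> \<open>The gaps are at most 8^-n, so the weight 4^n still leaves a sum over 2^-n.
    Boundedness of 4^n d^2 by 1 then means that the increments are at most 2^-n, hence
    summable.\<close>
  have "(\<integral>\<^sup>+x. (\<Sum>n. ennreal (4^n * (d n x)\<^sup>2)) \<partial>M) = (\<Sum>n. \<integral>\<^sup>+x. ennreal (4^n * (d n x)\<^sup>2) \<partial>M)"
    by (rule nn_integral_suminf) measurable
  also have "\<dots> \<le> (\<Sum>n. ennreal ((1/2)^n))"
  proof (intro suminf_le)
    fix n
    have "(\<integral>\<^sup>+x. ennreal (4^n * (d n x)\<^sup>2) \<partial>M) = ennreal (4^n) * (\<integral>\<^sup>+x. ennreal ((d n x)\<^sup>2) \<partial>M)"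
      by (simp add: ennreal_mult nn_integral_cmult)
    also have "\<dots> \<le> ennreal (4^n) * ennreal ((1/8)^n)"
      unfolding d_def by (intro mult_left_mono K rK rK') auto
    also have "\<dots> = ennreal ((1/2)^n)"
      by (subst ennreal_mult[symmetric]) (auto simp: power_mult_distrib[symmetric])
    finally show "(\<integral>\<^sup>+x. ennreal (4^n * (d n x)\<^sup>2) \<partial>M) \<le> ennreal ((1/2)^n)" .
  qed auto
  also have "\<dots> = ennreal (\<Sum>n. (1/2)^n)"
    by (intro suminf_ennreal2) auto
  also have "\<dots> < \<infinity>" by simp
  finally have "(\<integral>\<^sup>+x. (\<Sum>n. ennreal (4^n * (d n x)\<^sup>2)) \<partial>M) \<noteq> \<infinity>" by simp
  then have "AE x in M. (\<Sum>n. ennreal (4^n * (d n x)\<^sup>2)) \<noteq> \<infinity>"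
    by (intro nn_integral_PInf_AE) auto
  then have "AE x in M. convergent (\<lambda>n. f (r n) x)"
  proof eventually_elim
    case (elim x)
    have "summable (\<lambda>n. 4^n * (d n x)\<^sup>2)"
      using elim by (intro summable_suminf_not_top) auto
    then have "(\<lambda>n. 4^n * (d n x)\<^sup>2) \<longlonglongrightarrow> 0"
      by (rule summable_LIMSEQ_zero)
    then have "\<forall>\<^sub>F n in sequentially. 4^n * (d n x)\<^sup>2 < 1"
      by (rule order_tendstoD(2)) simp
    then have "\<forall>\<^sub>F n in sequentially. norm (d n x) \<le> (1/2)^n"
    proof eventually_elim
      case (elim n)
      have "(2^n * \<bar>d n x\<bar>)\<^sup>2 = 4^n * (d n x)\<^sup>2"
        by (simp add: power_mult_distrib power_mult[symmetric] mult.commute[of n])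
          (simp add: power_mult)
      with elim have "2^n * \<bar>d n x\<bar> < 1"
        by (smt (verit) one_le_power)
      then show ?case by (simp add: field_simps power_divide)
    qed
    then have "summable (\<lambda>n. d n x)"
      by (rule summable_comparison_test_ev) (simp add: summable_geometric)
    then have "convergent (\<lambda>n. \<Sum>i<n. d i x)"
      by (simp add: summable_iff_convergent)
    then have "convergent (\<lambda>n. (f (r n) x - f (r 0) x) + f (r 0) x)"
      unfolding d_def sum_lessThan_telescope[of "\<lambda>n. f (r n) x"] by (intro convergent_add convergent_const)
    then show ?case by simp
  qed
  with r that show thesis by blast
qed

lemma L2_complete:
  assumes f: "\<And>n. f n \<in> L2 M"
    and cauchy: "\<And>e::real. e > 0 \<Longrightarrow> \<exists>N. \<forall>m\<ge>N. \<forall>n\<ge>N. l2sq M (f m) (f n) \<le> e"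
  obtains g r where "g \<in> L2 M" "(\<lambda>n. l2sq M (f n) g) \<longlonglongrightarrow> 0" "strict_mono (r :: nat \<Rightarrow> nat)"
    "AE x in M. (\<lambda>n. f (r n) x) \<longlonglongrightarrow> g x"
proof -
  note [measurable] = L2_measurable[OF f]
  have c: "\<exists>N. \<forall>m\<ge>N. \<forall>n\<ge>N. (\<integral>\<^sup>+x. ennreal ((f m x - f n x)\<^sup>2) \<partial>M) \<le> ennreal e"
    if "e > 0" for e :: real
    using cauchy[OF that] that by (auto simp: l2sq_nn_integral[OF f f] ennreal_le_iff)
  obtain r :: "nat \<Rightarrow> nat" where r: "strict_mono r" and conv: "AE x in M. convergent (\<lambda>n. f (r n) x)"
    by (rule square_Cauchy_AE_subseq[of f M]) (use c in auto)
  define g where "g x = lim (\<lambda>n. f (r n) x)" for x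
  have [measurable]: "g \<in> borel_measurable M"
    unfolding g_def by measurable
  have lim: "AE x in M. (\<lambda>n. f (r n) x) \<longlonglongrightarrow> g x"
    using conv by eventually_elim (simp add: g_def convergent_LIMSEQ_iff)
  have fatou: "(\<integral>\<^sup>+x. ennreal ((f n x - g x)\<^sup>2) \<partial>M) \<le> ennreal e"
    if N: "\<forall>m\<ge>N. \<forall>n\<ge>N. l2sq M (f m) (f n) \<le> e" "n \<ge> N" for N n e
  proof -
    have "(\<integral>\<^sup>+x. ennreal ((f n x - g x)\<^sup>2) \<partial>M)
        = (\<integral>\<^sup>+x. liminf (\<lambda>k. ennreal ((f n x - f (r k) x)\<^sup>2)) \<partial>M)"
    proof (rule nn_integral_cong_AE)
      show "AE x in M. ennreal ((f n x - g x)\<^sup>2) = liminf (\<lambda>k. ennreal ((f n x - f (r k) x)\<^sup>2))"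
        using lim
      proof eventually_elim
        case (elim x)
        then have "(\<lambda>k. ennreal ((f n x - f (r k) x)\<^sup>2)) \<longlonglongrightarrow> ennreal ((f n x - g x)\<^sup>2)"
          by (intro tendsto_intros)
        then show ?case by (rule lim_imp_Liminf[OF sequentially_bot, symmetric])
      qed
    qed
    also have "\<dots> \<le> liminf (\<lambda>k. \<integral>\<^sup>+x. ennreal ((f n x - f (r k) x)\<^sup>2) \<partial>M)"
      by (rule nn_integral_liminf) measurable
    also have "\<dots> \<le> ennreal e"
    proof (rule Liminf_le)
      show "\<forall>\<^sub>F k in sequentially. (\<integral>\<^sup>+x. ennreal ((f n x - f (r k) x)\<^sup>2) \<partial>M) \<le> ennreal e"
      proof (rule eventually_sequentiallyI)
        fix k assume "k \<ge> N"
        then have "r k \<ge> N" using seq_suble[OF r, of k] by linarith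
        with N show "(\<integral>\<^sup>+x. ennreal ((f n x - f (r k) x)\<^sup>2) \<partial>M) \<le> ennreal e"
          by (simp add: l2sq_nn_integral[OF f f] ennreal_leI)
      qed
    qed simp
    finally show ?thesis .
  qed
  have gL: "g \<in> L2 M"
  proof -
    obtain N where N: "\<forall>m\<ge>N. \<forall>n\<ge>N. l2sq M (f m) (f n) \<le> 1"
      using cauchy[of 1] by auto
    have "(\<integral>\<^sup>+x. ennreal ((f N x - g x)\<^sup>2) \<partial>M) < \<infinity>"
      using fatou[OF N, of N] by (auto simp: less_top[symmetric] top_unique)
    then have "(\<lambda>x. f N x - g x) \<in> L2 M"
      by (simp add: L2_def integrable_iff_bounded)
    from L2_diff[OF f[of N] this] show ?thesis by simp
  qed
  have "(\<lambda>n. l2sq M (f n) g) \<longlonglongrightarrow> 0"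
  proof (rule LIMSEQ_I)
    fix e :: real assume e: "e > 0"
    then obtain N where N: "\<forall>m\<ge>N. \<forall>n\<ge>N. l2sq M (f m) (f n) \<le> e / 2"
      using cauchy[of "e / 2"] by auto
    have "norm (l2sq M (f n) g - 0) < e" if "n \<ge> N" for n
      using fatou[OF N that] e by (simp add: l2sq_nn_integral[OF f gL] ennreal_le_iff)
    then show "\<exists>N. \<forall>n\<ge>N. norm (l2sq M (f n) g - 0) < e" by blast
  qed
  with gL r lim that show thesis by blast
qed

section \<open>Midpoint hulls\<close>

text \<open>Dyadic convex combinations. Closure under midpoints is all that the defect argument
  uses, and each bound that survives a midpoint extends to the hull by a one-case induction.\<close>

inductive_set midhull :: "('a \<Rightarrow> real) set \<Rightarrow> ('a \<Rightarrow> real) set" for S where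
  base: "f \<in> S \<Longrightarrow> f \<in> midhull S"
| mid: "f \<in> midhull S \<Longrightarrow> g \<in> midhull S \<Longrightarrow> (\<lambda>x. (f x + g x) / 2) \<in> midhull S"

lemma midhull_mono:
  assumes "S \<subseteq> T" shows "midhull S \<subseteq> midhull T"
proof
  fix f assume "f \<in> midhull S"
  then show "f \<in> midhull T"
    by induction (use assms in \<open>auto intro: midhull.intros\<close>)
qed

lemma midhull_ge: "f \<in> midhull S \<Longrightarrow> (\<And>f. f \<in> S \<Longrightarrow> c \<le> f x) \<Longrightarrow> c \<le> f x"
proof (induction rule: midhull.induct)
  case (mid f g)
  then have "c \<le> f x" "c \<le> g x" by blast+
  then show ?case by simp
qed blast

lemma midhull_le: "f \<in> midhull S \<Longrightarrow> (\<And>f. f \<in> S \<Longrightarrow> f x \<le> c) \<Longrightarrow> f x \<le> c"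
proof (induction rule: midhull.induct)
  case (mid f g)
  then have "f x \<le> c" "g x \<le> c" by blast+
  then show ?case by simp
qed blast

lemma midhull_measurable:
  "f \<in> midhull S \<Longrightarrow> S \<subseteq> borel_measurable M \<Longrightarrow> f \<in> borel_measurable M"
  by (induction rule: midhull.induct) auto

lemma midhull_L2: "f \<in> midhull S \<Longrightarrow> S \<subseteq> L2 M \<Longrightarrow> f \<in> L2 M"
  by (induction rule: midhull.induct) (auto intro: L2_mid)

lemma midhull_l2sq_le:
  "f \<in> midhull S \<Longrightarrow> S \<subseteq> L2 M \<Longrightarrow> u \<in> L2 M \<Longrightarrow> (\<And>f. f \<in> S \<Longrightarrow> l2sq M f u \<le> c) \<Longrightarrow> l2sq M f u \<le> c"
proof (induction rule: midhull.induct)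
  case (mid f g)
  have "l2sq M (\<lambda>x. (f x + g x) / 2) u \<le> (l2sq M f u + l2sq M g u) / 2"
    using l2sq_parallelogram[OF midhull_L2[OF mid.hyps(1) mid.prems(1)] midhull_L2[OF mid.hyps(2) mid.prems(1)] mid.prems(2)]
      l2sq_nonneg[of M f g] by linarith
  with mid show ?case by fastforce
qed auto

text \<open>At a fixed point, every interval containing the tail of the sequence contains the values
  of the tail hull. Passing to combinations therefore never changes a limit that is already
  present.\<close>

lemma midhull_tail_tendsto:
  fixes \<phi> :: "nat \<Rightarrow> 'a \<Rightarrow> real"
  assumes g: "\<And>n. g n \<in> midhull (\<phi> ` {n..})" and lim: "(\<lambda>n. \<phi> n x) \<longlonglongrightarrow> l"
  shows "(\<lambda>n. g n x) \<longlonglongrightarrow> l"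
proof (rule LIMSEQ_I)
  fix e :: real assume e: "e > 0"
  then obtain N where N: "\<And>n. n \<ge> N \<Longrightarrow> \<bar>\<phi> n x - l\<bar> < e / 2"
    using LIMSEQ_D[OF lim, of "e / 2"] by auto
  have b: "l - e / 2 \<le> \<phi> k x \<and> \<phi> k x \<le> l + e / 2" if "k \<ge> N" for k
    using N[OF that] by linarith
  have "norm (g n x - l) < e" if n: "n \<ge> N" for n
  proof -
    have "l - e / 2 \<le> g n x" by (rule midhull_ge[OF g]) (use b n in auto)
    moreover have "g n x \<le> l + e / 2" by (rule midhull_le[OF g]) (use b n in auto)
    ultimately show ?thesis using e by auto
  qed
  then show "\<exists>N. \<forall>n\<ge>N. norm (g n x - l) < e" by blast
qed

text \<open>The infima \<open>a n\<close> over the shrinking hulls increase to a finite A. For m, n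
  \<ge> N the midpoint of \<open>g m\<close> and \<open>g n\<close> is still in the hull of index N,
  so J is at least \<open>a N\<close> there, while J is at most A + 1/(N+1) at both ends. Convexity
  of J enters only when the defect is interpreted as a distance.\<close>

lemma midhull_small_defect:
  fixes J :: "('a \<Rightarrow> real) \<Rightarrow> real" and \<phi> :: "nat \<Rightarrow> 'a \<Rightarrow> real"
  assumes J0: "\<And>f. 0 \<le> J f" and bound: "\<And>k. J (\<phi> k) \<le> B"
  obtains g where "\<And>n. g n \<in> midhull (\<phi> ` {n..})"
    "\<And>e. e > 0 \<Longrightarrow> \<exists>N. \<forall>m\<ge>N. \<forall>n\<ge>N. (J (g m) + J (g n)) / 2 - J (\<lambda>x. (g m x + g n x) / 2) < e"
proof -
  define H where "H n = midhull (\<phi> ` {n..})" for n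
  define a where "a n = Inf (J ` H n)" for n
  have bdd: "bdd_below (J ` H n)" for n using J0 by (auto intro!: bdd_belowI[of _ 0])
  have \<phi>H: "\<phi> n \<in> H n" for n unfolding H_def by (rule midhull.base) auto
  have Hmono: "H n \<subseteq> H m" if "m \<le> n" for m n
    unfolding H_def using that by (intro midhull_mono image_mono) auto
  have "incseq a"
    unfolding a_def incseq_def
    using Hmono \<phi>H by (intro allI impI cInf_superset_mono bdd image_mono) blast+
  moreover have "a n \<le> B" for n
    unfolding a_def using bound[of n] \<phi>H[of n] by (intro cInf_lower2[OF _ _ bdd]) auto
  ultimately obtain A where A: "a \<longlonglongrightarrow> A" "\<And>n. a n \<le> A"
    using incseq_convergent[of a B] by blast
  have "\<exists>g\<in>H n. J g < a n + 1 / real (Suc n)" for n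
  proof -
    have "Inf (J ` H n) < a n + 1 / real (Suc n)" by (simp add: a_def)
    then show ?thesis using cInf_lessD[of "J ` H n"] \<phi>H[of n] by blast
  qed
  then obtain g where g: "\<And>n. g n \<in> H n" "\<And>n. J (g n) < a n + 1 / real (Suc n)" by metis
  have "\<exists>N. \<forall>m\<ge>N. \<forall>n\<ge>N. (J (g m) + J (g n)) / 2 - J (\<lambda>x. (g m x + g n x) / 2) < e" if e: "e > 0" for e
  proof -
    have "(\<lambda>N. A + 1 / real (Suc N) - a N) \<longlonglongrightarrow> A + 0 - A"
      by (intro tendsto_intros A LIMSEQ_Suc[OF lim_1_over_n])
    then have "\<forall>\<^sub>F N in sequentially. A + 1 / real (Suc N) - a N < e"
      using e by (intro order_tendstoD(2)) auto
    then obtain N where N: "A + 1 / real (Suc N) - a N < e"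
      by (auto simp: eventually_sequentially)
    have le: "J (g n) \<le> A + 1 / real (Suc N)" if "n \<ge> N" for n
    proof -
      have "1 / real (Suc n) \<le> 1 / real (Suc N)" using that by (simp add: field_simps)
      with g(2)[of n] A(2)[of n] show ?thesis by linarith
    qed
    have lower: "a N \<le> J (\<lambda>x. (g m x + g n x) / 2)" if "m \<ge> N" "n \<ge> N" for m n
    proof -
      have "(\<lambda>x. (g m x + g n x) / 2) \<in> H N"
        using g(1)[of m] g(1)[of n] Hmono[OF that(1)] Hmono[OF that(2)]
        unfolding H_def by (intro midhull.mid) auto
      then show ?thesis unfolding a_def by (intro cInf_lower bdd imageI)
    qed
    have upper: "(J (g m) + J (g n)) / 2 \<le> A + 1 / real (Suc N)" if "m \<ge> N" "n \<ge> N" for m n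
      using le[OF that(1)] le[OF that(2)] by simp
    have "(J (g m) + J (g n)) / 2 - J (\<lambda>x. (g m x + g n x) / 2) < e" if "m \<ge> N" "n \<ge> N" for m n
      using lower[OF that] upper[OF that] N by linarith
    then show ?thesis by blast
  qed
  with g that show thesis by (auto simp: H_def)
qed

text \<open>The almost minimisers of the norm on the tail hulls form a Cauchy sequence; this replaces
  weak compactness together with Mazur's lemma.\<close>
lemma L2_bounded_midhull_convergent:
  assumes \<phi>: "\<And>k. \<phi> k \<in> L2 M" and bound: "\<And>k. l2sq M (\<phi> k) (\<lambda>x. 0) \<le> B"
  obtains g ginf where "\<And>n. g n \<in> midhull (\<phi> ` {n..})" "ginf \<in> L2 M"
    "(\<lambda>n. l2sq M (g n) ginf) \<longlonglongrightarrow> 0" "AE x in M. (\<lambda>n. g n x) \<longlonglongrightarrow> ginf x"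
proof -
  obtain g where g: "\<And>n. g n \<in> midhull (\<phi> ` {n..})"
    and d: "\<And>e. e > 0 \<Longrightarrow> \<exists>N. \<forall>m\<ge>N. \<forall>n\<ge>N. (l2sq M (g m) (\<lambda>x. 0) + l2sq M (g n) (\<lambda>x. 0)) / 2
        - l2sq M (\<lambda>x. (g m x + g n x) / 2) (\<lambda>x. 0) < e"
    using midhull_small_defect[of "\<lambda>f. l2sq M f (\<lambda>x. 0)" \<phi> B] bound by auto
  have gL: "g n \<in> L2 M" for n using \<phi> by (intro midhull_L2[OF g]) auto
  have cauchy: "\<exists>N. \<forall>m\<ge>N. \<forall>n\<ge>N. l2sq M (g m) (g n) \<le> e" if "e > 0" for e :: real
  proof -
    obtain N where N: "\<forall>m\<ge>N. \<forall>n\<ge>N. (l2sq M (g m) (\<lambda>x. 0) + l2sq M (g n) (\<lambda>x. 0)) / 2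
        - l2sq M (\<lambda>x. (g m x + g n x) / 2) (\<lambda>x. 0) < e / 4"
      using d[of "e / 4"] \<open>e > 0\<close> by force
    have "l2sq M (g m) (g n) / 4 \<le> e / 4" if "m \<ge> N" "n \<ge> N" for m n
      using l2sq_parallelogram[OF gL[of m] gL[of n] L2_zero]
        N[rule_format, OF that] by linarith
    then show ?thesis by auto
  qed
  obtain ginf and r :: "nat \<Rightarrow> nat" where lim: "ginf \<in> L2 M" "(\<lambda>n. l2sq M (g n) ginf) \<longlonglongrightarrow> 0" "strict_mono r"
    "AE x in M. (\<lambda>n. g (r n) x) \<longlonglongrightarrow> ginf x"
    by (rule L2_complete[OF gL cauchy])
  show thesis
  proof (rule that[of "\<lambda>n. g (r n)" ginf])
    show "g (r n) \<in> midhull (\<phi> ` {n..})" for n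
      using g[of "r n"] seq_suble[OF lim(3), of n] midhull_mono[of "\<phi> ` {r n..}" "\<phi> ` {n..}"]
      by (meson atLeast_subset_iff image_mono subsetD)
    show "(\<lambda>n. l2sq M (g (r n)) ginf) \<longlonglongrightarrow> 0"
      using LIMSEQ_subseq_LIMSEQ[OF lim(2,3)] by (simp add: o_def)
  qed (use lim in auto)
qed

section \<open>Forms and their resolvents\<close>

lemma ennreal_half_add_half: "ennreal (1/2) * c + ennreal (1/2) * c = c"
proof -
  have "ennreal (1/2) * c + ennreal (1/2) * c = (ennreal (1/2) + ennreal (1/2)) * c"
    by (simp add: distrib_right)
  also have "ennreal (1/2) + ennreal (1/2) = 1"
    by (subst ennreal_plus[symmetric]) auto
  finally show ?thesis by simp
qed

lemma ennreal_liminf_add_le: "liminf u + liminf v \<le> liminf (\<lambda>n. u n + v n :: ennreal)"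
proof -
  have inc: "incseq (\<lambda>n. INF m\<in>{n..}. w m)" for w :: "nat \<Rightarrow> ennreal"
    by (auto simp: incseq_def intro!: INF_superset_mono)
  have "liminf u + liminf v = (SUP n. (INF m\<in>{n..}. u m) + (INF m\<in>{n..}. v m))"
    unfolding liminf_SUP_INF by (rule ennreal_SUP_add[OF inc inc, symmetric])
  also have "\<dots> \<le> (SUP n. INF m\<in>{n..}. u m + v m)"
    by (intro SUP_mono' INF_greatest add_mono INF_lower) auto
  finally show ?thesis unfolding liminf_SUP_INF .
qed

lemma less_add_inverse_Suc: "a < \<infinity> \<Longrightarrow> a < a + ennreal (1 / real (Suc n))"
  by (simp add: ennreal_add_left_cancel_less)

lemma tendsto_add_inverse_Suc: "(\<lambda>n. a + ennreal (1 / real (Suc n))) \<longlonglongrightarrow> a"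
proof -
  have "(\<lambda>n. a + ennreal (1 / real (Suc n))) \<longlonglongrightarrow> a + ennreal 0"
    by (intro tendsto_add tendsto_const tendsto_ennrealI LIMSEQ_Suc[OF lim_1_over_n])
  then show ?thesis by simp
qed

lemma l2sq_triangle:
  assumes f: "f \<in> L2 M" and g: "g \<in> L2 M" and h: "h \<in> L2 M"
  shows "l2sq M f h \<le> 2 * l2sq M f g + 2 * l2sq M g h"
proof -
  have "(f x - h x)\<^sup>2 \<le> 2 * (f x - g x)\<^sup>2 + 2 * (g x - h x)\<^sup>2" for x
    using sum_squares_bound[of "f x - g x" "g x - h x"] power2_sum[of "f x - g x" "g x - h x"] by simp
  then have "l2sq M f h \<le> (\<integral>x. 2 * (f x - g x)\<^sup>2 + 2 * (g x - h x)\<^sup>2 \<partial>M)"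
    unfolding l2sq_def using l2sq_integrable[OF f g] l2sq_integrable[OF g h] l2sq_integrable[OF f h]
    by (intro integral_mono) auto
  also have "\<dots> = 2 * l2sq M f g + 2 * l2sq M g h"
    unfolding l2sq_def using l2sq_integrable[OF f g] l2sq_integrable[OF g h] by simp
  finally show ?thesis .
qed

lemma (in sigma_finite_measure) positive_integrable_L2_function:
  obtains p :: "'a \<Rightarrow> real" where "p \<in> borel_measurable M" "\<And>x. p x > 0" "integrable M p" "p \<in> L2 M"
proof -
  obtain p :: "'a \<Rightarrow> real" where p: "p \<in> borel_measurable M" "\<And>x. p x > 0" "\<And>x. p x \<le> 1" "integrable M p"
    using obtain_positive_integrable_function by blast
  have pL: "p \<in> L2 M"
  proof -
    have "integrable M (\<lambda>x. (p x)\<^sup>2)"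
    proof (rule Bochner_Integration.integrable_bound[OF p(4)])
      show "AE x in M. norm ((p x)\<^sup>2) \<le> norm (p x)"
        using p(2,3) by (intro AE_I2) (auto simp: power2_eq_square less_imp_le mult_left_le)
    qed (use p in auto)
    then show ?thesis using p by (simp add: L2_def)
  qed
  with p that show thesis by blast
qed

section \<open>Convexity and lattice inequalities for the form\<close>

locale order_preserving_form = sigma_finite_measure M for M :: "'a measure" +
  fixes E :: "('a \<Rightarrow> real) \<Rightarrow> ennreal"
  assumes form: "nonlinear_order_preserving_form M E"
begin

lemma E_cong_AE: "f \<in> L2 M \<Longrightarrow> g \<in> L2 M \<Longrightarrow> AE x in M. f x = g x \<Longrightarrow> E f = E g"
  using form unfolding nonlinear_order_preserving_form_def by blast

lemma E_lsc: "(\<And>n. fs n \<in> L2 M) \<Longrightarrow> f \<in> L2 M \<Longrightarrow> (\<lambda>n. l2sq M (fs n) f) \<longlonglongrightarrow> 0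
    \<Longrightarrow> E f \<le> liminf (\<lambda>n. E (fs n))"
  using form unfolding nonlinear_order_preserving_form_def by blast

lemma E_convex: "f \<in> L2 M \<Longrightarrow> g \<in> L2 M \<Longrightarrow> 0 < t \<Longrightarrow> t < 1 \<Longrightarrow>
    E (\<lambda>x. t * f x + (1 - t) * g x) \<le> ennreal t * E f + ennreal (1 - t) * E g"
  using form unfolding nonlinear_order_preserving_form_def by blast

lemma E_uminus: "f \<in> L2 M \<Longrightarrow> E (\<lambda>x. - f x) = E f"
  using form unfolding nonlinear_order_preserving_form_def by blast

lemma E_zero [simp]: "E (\<lambda>x. 0) = 0"
  using form unfolding nonlinear_order_preserving_form_def by blast

lemma E_abs: "f \<in> L2 M \<Longrightarrow> g \<in> L2 M \<Longrightarrow>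
    E (\<lambda>x. f x + \<bar>g x\<bar>) + E (\<lambda>x. f x - \<bar>g x\<bar>) \<le> E (\<lambda>x. f x + g x) + E (\<lambda>x. f x - g x)"
  using form unfolding nonlinear_order_preserving_form_def by blast

text \<open>The axiom with absolute values is submodularity in other coordinates: take the mean of u
  and v for f and their half-difference for g.\<close>

lemma E_min_max:
  assumes u: "u \<in> L2 M" and v: "v \<in> L2 M"
  shows "E (\<lambda>x. min (u x) (v x)) + E (\<lambda>x. max (u x) (v x)) \<le> E u + E v"
proof -
  let ?f = "\<lambda>x. (u x + v x) / 2" and ?g = "\<lambda>x. (u x - v x) / 2"
  have "?f \<in> L2 M" "?g \<in> L2 M" using u v by (auto intro!: L2_intros)
  then have "E (\<lambda>x. ?f x + \<bar>?g x\<bar>) + E (\<lambda>x. ?f x - \<bar>?g x\<bar>) \<le> E (\<lambda>x. ?f x + ?g x) + E (\<lambda>x. ?f x - ?g x)"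
    by (rule E_abs)
  moreover have "(\<lambda>x. ?f x + \<bar>?g x\<bar>) = (\<lambda>x. max (u x) (v x))" "(\<lambda>x. ?f x - \<bar>?g x\<bar>) = (\<lambda>x. min (u x) (v x))"
      "(\<lambda>x. ?f x + ?g x) = u" "(\<lambda>x. ?f x - ?g x) = v"
    by (auto simp: fun_eq_iff max_def min_def field_simps abs_if)
  ultimately show ?thesis by (simp add: add.commute)
qed

text \<open>Submodularity against the zero function, with the nonnegative energy of
  \<open>min 0 f\<close> dropped. It allows approximating sequences to be truncated at 0.\<close>

lemma E_max_zero_le: "f \<in> L2 M \<Longrightarrow> E (\<lambda>x. max 0 (f x)) \<le> E f"
  using E_min_max[OF L2_zero, of f] by (auto intro: order_trans[rotated] add_increasing)

lemma E_mid: "f \<in> L2 M \<Longrightarrow> g \<in> L2 M \<Longrightarrow> E (\<lambda>x. (f x + g x) / 2) \<le> ennreal (1/2) * E f + ennreal (1/2) * E g"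
  using E_convex[of f g "1/2"] by (simp add: add_divide_distrib)

lemma E_scale:
  assumes "f \<in> L2 M" "0 \<le> t" "t \<le> 1"
  shows "E (\<lambda>x. t * f x) \<le> ennreal t * E f"
proof (cases "t = 0 \<or> t = 1")
  case False
  then show ?thesis using E_convex[OF assms(1) L2_zero, of t] assms by auto
qed auto

lemma midhull_E_le:
  "f \<in> midhull S \<Longrightarrow> S \<subseteq> L2 M \<Longrightarrow> (\<And>f. f \<in> S \<Longrightarrow> E f \<le> c) \<Longrightarrow> E f \<le> c"
proof (induction rule: midhull.induct)
  case (mid f g)
  have "E (\<lambda>x. (f x + g x) / 2) \<le> ennreal (1/2) * E f + ennreal (1/2) * E g"
    using mid.hyps mid.prems by (intro E_mid midhull_L2)
  also have "\<dots> \<le> ennreal (1/2) * c + ennreal (1/2) * c"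
    by (intro add_mono mult_left_mono mid) auto
  finally show ?case by (simp only: ennreal_half_add_half)
qed auto

section \<open>Resolvents as minimisers of a uniformly convex functional\<close>

definition objective :: "real \<Rightarrow> ('a \<Rightarrow> real) \<Rightarrow> ('a \<Rightarrow> real) \<Rightarrow> ennreal" where
  "objective \<alpha> u k = E k + ennreal (\<alpha> / 2 * l2sq M k (\<lambda>x. u x / \<alpha>))"

text \<open>Convexity of \<open>E\<close> together with the parallelogram law; \<alpha>/8 is
  \<alpha>/2 times the quarter found there. The gap stands on the left as a summand, so that no
  subtraction in \<open>ennreal\<close> occurs.\<close>

lemma objective_mid:
  assumes f: "f \<in> L2 M" and g: "g \<in> L2 M" and u: "u \<in> L2 M" and \<alpha>: "\<alpha> > 0"
  shows "objective \<alpha> u (\<lambda>x. (f x + g x) / 2) + ennreal (\<alpha> / 8 * l2sq M f g)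
    \<le> ennreal (1/2) * objective \<alpha> u f + ennreal (1/2) * objective \<alpha> u g"
proof -
  let ?v = "\<lambda>x. u x / \<alpha>" and ?m = "\<lambda>x. (f x + g x) / 2"
  have v: "?v \<in> L2 M" using u by (rule L2_divide)
  have "\<alpha> / 2 * l2sq M ?m ?v + \<alpha> / 8 * l2sq M f g
      = 1 / 2 * (\<alpha> / 2 * l2sq M f ?v) + 1 / 2 * (\<alpha> / 2 * l2sq M g ?v)"
  proof -
    have "1 / 2 * (\<alpha> / 2 * l2sq M f ?v) + 1 / 2 * (\<alpha> / 2 * l2sq M g ?v)
        = \<alpha> / 2 * ((l2sq M f ?v + l2sq M g ?v) / 2)" by (simp add: algebra_simps)
    also have "\<dots> = \<alpha> / 2 * (l2sq M ?m ?v + l2sq M f g / 4)"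
      by (simp only: l2sq_parallelogram[OF f g v])
    finally show ?thesis by (simp add: algebra_simps)
  qed
  then have *: "ennreal (\<alpha> / 2 * l2sq M ?m ?v) + ennreal (\<alpha> / 8 * l2sq M f g)
      = ennreal (1/2) * ennreal (\<alpha> / 2 * l2sq M f ?v) + ennreal (1/2) * ennreal (\<alpha> / 2 * l2sq M g ?v)"
    using \<alpha> by (subst (1 2) ennreal_mult[symmetric]) (simp_all only: ennreal_plus[symmetric]
      l2sq_nonneg mult_nonneg_nonneg divide_nonneg_nonneg less_imp_le zero_le_numeral zero_le_one)
  have "objective \<alpha> u ?m + ennreal (\<alpha> / 8 * l2sq M f g)
      = E ?m + (ennreal (1/2) * ennreal (\<alpha> / 2 * l2sq M f ?v) + ennreal (1/2) * ennreal (\<alpha> / 2 * l2sq M g ?v))"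
    unfolding objective_def by (simp only: * add.assoc)
  also have "\<dots> \<le> (ennreal (1/2) * E f + ennreal (1/2) * E g)
      + (ennreal (1/2) * ennreal (\<alpha> / 2 * l2sq M f ?v) + ennreal (1/2) * ennreal (\<alpha> / 2 * l2sq M g ?v))"
    by (intro add_right_mono E_mid f g)
  also have "\<dots> = ennreal (1/2) * objective \<alpha> u f + ennreal (1/2) * objective \<alpha> u g"
    unfolding objective_def by (simp only: distrib_left add_ac)
  finally show ?thesis .
qed

lemma midhull_objective_le:
  assumes "u \<in> L2 M" "\<alpha> > 0"
  shows "f \<in> midhull S \<Longrightarrow> S \<subseteq> L2 M \<Longrightarrow> (\<And>f. f \<in> S \<Longrightarrow> objective \<alpha> u f \<le> c) \<Longrightarrow> objective \<alpha> u f \<le> c"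
proof (induction rule: midhull.induct)
  case (mid f g)
  have "objective \<alpha> u (\<lambda>x. (f x + g x) / 2)
      \<le> objective \<alpha> u (\<lambda>x. (f x + g x) / 2) + ennreal (\<alpha> / 8 * l2sq M f g)" by simp
  also have "\<dots> \<le> ennreal (1/2) * objective \<alpha> u f + ennreal (1/2) * objective \<alpha> u g"
    using midhull_L2[OF mid.hyps(1) mid.prems(1)] midhull_L2[OF mid.hyps(2) mid.prems(1)] assms
    by (rule objective_mid)
  also have "\<dots> \<le> ennreal (1/2) * c + ennreal (1/2) * c"
    by (intro add_mono mult_left_mono mid) auto
  finally show ?case by (simp only: ennreal_half_add_half)
qed auto

lemma objective_zero_finite: "objective \<alpha> u (\<lambda>x. 0) < \<infinity>"
  by (simp add: objective_def)

text \<open>The direct method with hull elements in place of weak limits. The quadratic term bounds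
  a minimising sequence in L2, hull elements remain almost minimal, and their strong convergence
  allows lower semicontinuity of \<open>E\<close> and continuity of the quadratic term to be
  used.\<close>

lemma objective_minimizer_exists:
  assumes u: "u \<in> L2 M" and \<alpha>: "\<alpha> > 0"
  shows "\<exists>g\<in>L2 M. \<forall>k\<in>L2 M. objective \<alpha> u g \<le> objective \<alpha> u k"
proof -
  let ?v = "\<lambda>x. u x / \<alpha>"
  have v: "?v \<in> L2 M" using u by (rule L2_divide)
  define m where "m = (INF k\<in>L2 M. objective \<alpha> u k)"
  have "m \<le> objective \<alpha> u (\<lambda>x. 0)" unfolding m_def by (rule INF_lower) simp
  then have mfin: "m < \<infinity>" using objective_zero_finite[of \<alpha> u] by (rule le_less_trans)
  have "\<exists>\<phi>\<in>L2 M. objective \<alpha> u \<phi> < m + ennreal (1 / real (Suc k))" for k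
  proof -
    have "m < m + ennreal (1 / real (Suc k))" using mfin by (simp add: ennreal_add_left_cancel_less)
    then show ?thesis unfolding m_def by (simp add: INF_less_iff)
  qed
  then obtain \<phi> where \<phi>: "\<And>k. \<phi> k \<in> L2 M" "\<And>k. objective \<alpha> u (\<phi> k) < m + ennreal (1 / real (Suc k))"
    by metis
  obtain c where c: "c \<ge> 0" "m + 1 = ennreal c"
    using mfin by (cases "m + 1") auto
  have bound: "l2sq M (\<phi> k) (\<lambda>x. 0) \<le> 2 * (2 * c / \<alpha>) + 2 * l2sq M ?v (\<lambda>x. 0)" for k
  proof -
    have "ennreal (\<alpha> / 2 * l2sq M (\<phi> k) ?v) \<le> objective \<alpha> u (\<phi> k)" by (simp add: objective_def)
    also have "\<dots> \<le> m + ennreal (1 / real (Suc k))" using \<phi>(2)[of k] by simp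
    also have "\<dots> \<le> m + 1" by (intro add_left_mono) (simp add: ennreal_le_1)
    finally have "\<alpha> / 2 * l2sq M (\<phi> k) ?v \<le> c" using c by (simp add: ennreal_le_iff)
    then have "l2sq M (\<phi> k) ?v \<le> 2 * c / \<alpha>" using \<alpha> by (simp add: field_simps)
    with l2sq_triangle[OF \<phi>(1)[of k] v L2_zero] show ?thesis by linarith
  qed
  obtain g w where g: "\<And>n. g n \<in> midhull (\<phi> ` {n..})" and w: "w \<in> L2 M"
    and lim: "(\<lambda>n. l2sq M (g n) w) \<longlonglongrightarrow> 0" and "AE x in M. (\<lambda>n. g n x) \<longlonglongrightarrow> w x"
    using L2_bounded_midhull_convergent[of \<phi>, OF \<phi>(1) bound] by blast
  have gL: "g n \<in> L2 M" for n using \<phi>(1) by (intro midhull_L2[OF g]) auto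
  have gle: "objective \<alpha> u (g n) \<le> m + ennreal (1 / real (Suc n))" for n
  proof (rule midhull_objective_le[OF u \<alpha> g])
    fix f assume "f \<in> \<phi> ` {n..}"
    then obtain k where k: "k \<ge> n" "f = \<phi> k" by auto
    then have "objective \<alpha> u f \<le> m + ennreal (1 / real (Suc k))" using \<phi>(2)[of k] by simp
    also have "\<dots> \<le> m + ennreal (1 / real (Suc n))"
      using k by (intro add_left_mono ennreal_leI) (simp add: field_simps)
    finally show "objective \<alpha> u f \<le> m + ennreal (1 / real (Suc n))" .
  qed (use \<phi> in auto)
  have "objective \<alpha> u w \<le> liminf (\<lambda>n. E (g n)) + liminf (\<lambda>n. ennreal (\<alpha> / 2 * l2sq M (g n) ?v))"
    unfolding objective_def
  proof (intro add_mono E_lsc gL w lim)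
    have "(\<lambda>n. ennreal (\<alpha> / 2 * l2sq M (g n) ?v)) \<longlonglongrightarrow> ennreal (\<alpha> / 2 * l2sq M w ?v)"
      by (intro tendsto_ennrealI tendsto_mult tendsto_const l2sq_tendsto gL w v lim)
    then show "ennreal (\<alpha> / 2 * l2sq M w ?v) \<le> liminf (\<lambda>n. ennreal (\<alpha> / 2 * l2sq M (g n) ?v))"
      using lim_imp_Liminf[OF sequentially_bot] by fastforce
  qed
  also have "\<dots> \<le> liminf (\<lambda>n. objective \<alpha> u (g n))"
    unfolding objective_def by (rule ennreal_liminf_add_le)
  also have "\<dots> \<le> liminf (\<lambda>n. m + ennreal (1 / real (Suc n)))"
    by (intro Liminf_mono always_eventually allI gle)
  also have "\<dots> = m"
    by (rule lim_imp_Liminf[OF sequentially_bot tendsto_add_inverse_Suc])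
  finally have "objective \<alpha> u w \<le> m" .
  then show ?thesis using w unfolding m_def by (meson INF_lower order_trans)
qed

lemma resolvent_L2: "u \<in> L2 M \<Longrightarrow> \<alpha> > 0 \<Longrightarrow> resolvent M E \<alpha> u \<in> L2 M"
  and resolvent_minimal: "u \<in> L2 M \<Longrightarrow> \<alpha> > 0 \<Longrightarrow> k \<in> L2 M \<Longrightarrow>
    objective \<alpha> u (resolvent M E \<alpha> u) \<le> objective \<alpha> u k"
proof -
  assume *: "u \<in> L2 M" "\<alpha> > 0"
  have "\<exists>g. g \<in> L2 M \<and> (\<forall>k\<in>L2 M. objective \<alpha> u g \<le> objective \<alpha> u k)"
    using objective_minimizer_exists[OF *] by blast
  then have "resolvent M E \<alpha> u \<in> L2 M \<and> (\<forall>k\<in>L2 M. objective \<alpha> u (resolvent M E \<alpha> u) \<le> objective \<alpha> u k)"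
    unfolding resolvent_def objective_def by (rule someI_ex)
  then show "resolvent M E \<alpha> u \<in> L2 M"
    "k \<in> L2 M \<Longrightarrow> objective \<alpha> u (resolvent M E \<alpha> u) \<le> objective \<alpha> u k" by auto
qed

lemma resolvent_objective_finite: "u \<in> L2 M \<Longrightarrow> \<alpha> > 0 \<Longrightarrow> objective \<alpha> u (resolvent M E \<alpha> u) < \<infinity>"
  using resolvent_minimal[OF _ _ L2_zero] objective_zero_finite by (meson le_less_trans)

text \<open>If g does at least as well as the resolvent, their midpoint would beat the minimum by
  \<alpha>/8 times the squared distance. The order properties of resolvents follow from this by
  showing that a minimum of two functions does no worse.\<close>

lemma resolvent_unique:
  assumes u: "u \<in> L2 M" and \<alpha>: "\<alpha> > 0" and g: "g \<in> L2 M"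
    and le: "objective \<alpha> u g \<le> objective \<alpha> u (resolvent M E \<alpha> u)"
  shows "AE x in M. g x = resolvent M E \<alpha> u x"
proof -
  let ?w = "resolvent M E \<alpha> u"
  define m where "m = objective \<alpha> u ?w"
  have w: "?w \<in> L2 M" using u \<alpha> by (rule resolvent_L2)
  have "m + ennreal (\<alpha> / 8 * l2sq M g ?w) \<le> objective \<alpha> u (\<lambda>x. (g x + ?w x) / 2) + ennreal (\<alpha> / 8 * l2sq M g ?w)"
    unfolding m_def by (intro add_right_mono resolvent_minimal u \<alpha> L2_mid g w)
  also have "\<dots> \<le> ennreal (1/2) * objective \<alpha> u g + ennreal (1/2) * objective \<alpha> u ?w"
    by (rule objective_mid[OF g w u \<alpha>])
  also have "\<dots> \<le> ennreal (1/2) * m + ennreal (1/2) * m"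
    unfolding m_def by (intro add_mono mult_left_mono le) auto
  also have "\<dots> = m + 0" by (simp only: ennreal_half_add_half add_0_right)
  finally have "ennreal (\<alpha> / 8 * l2sq M g ?w) \<le> 0"
    using resolvent_objective_finite[OF u \<alpha>] unfolding m_def by (simp only: ennreal_add_left_cancel_le) auto
  then have "l2sq M g ?w = 0" using \<alpha> l2sq_nonneg[of M g ?w] by (simp add: ennreal_eq_0_iff mult_le_0_iff)
  then show ?thesis by (rule l2sq_eq_0[OF g w])
qed

text \<open>An exchange argument: give the minimum p of the two resolvents to u and the maximum q to
  u'. The total objective does not increase, by submodularity of \<open>E\<close> and a
  rearrangement inequality for the squares. As q cannot beat w', p does no worse than w, so p =
  w.\<close>

lemma resolvent_mono:
  assumes u: "u \<in> L2 M" and u': "u' \<in> L2 M" and \<alpha>: "\<alpha> > 0"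
    and le: "AE x in M. u x \<le> u' x"
  shows "AE x in M. resolvent M E \<alpha> u x \<le> resolvent M E \<alpha> u' x"
proof -
  let ?a = "\<lambda>x. u x / \<alpha>" and ?b = "\<lambda>x. u' x / \<alpha>"
  define w w' where "w = resolvent M E \<alpha> u" and "w' = resolvent M E \<alpha> u'"
  define p q where "p = (\<lambda>x. min (w x) (w' x))" and "q = (\<lambda>x. max (w x) (w' x))"
  have L: "w \<in> L2 M" "w' \<in> L2 M" "p \<in> L2 M" "q \<in> L2 M" "?a \<in> L2 M" "?b \<in> L2 M"
    unfolding w_def w'_def p_def q_def using u u' \<alpha> by (auto intro!: L2_intros resolvent_L2)
  note i = l2sq_integrable[OF L(1,5)] l2sq_integrable[OF L(2,6)]
    l2sq_integrable[OF L(3,5)] l2sq_integrable[OF L(4,6)]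
  have "l2sq M p ?a + l2sq M q ?b = (\<integral>x. (p x - ?a x)\<^sup>2 + (q x - ?b x)\<^sup>2 \<partial>M)"
    unfolding l2sq_def by (rule Bochner_Integration.integral_add[OF i(3,4), symmetric])
  also have "\<dots> \<le> (\<integral>x. (w x - ?a x)\<^sup>2 + (w' x - ?b x)\<^sup>2 \<partial>M)"
  proof (rule integral_mono_AE)
    show "AE x in M. (p x - ?a x)\<^sup>2 + (q x - ?b x)\<^sup>2 \<le> (w x - ?a x)\<^sup>2 + (w' x - ?b x)\<^sup>2"
      using le
    proof eventually_elim
      case (elim x)
      then have ab: "?a x \<le> ?b x" using \<alpha> by (simp add: divide_right_mono)
      show ?case
      proof (cases "w x \<le> w' x")
        case False
        \<comment> \<open>The product of the two ordered differences is half of what is gained by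
          exchanging w and w' in the quadratic terms.\<close>
        then have "0 \<le> 2 * ((w x - w' x) * (?b x - ?a x))" using ab by simp
        also have "\<dots> = ((w x - ?a x)\<^sup>2 + (w' x - ?b x)\<^sup>2) - ((w' x - ?a x)\<^sup>2 + (w x - ?b x)\<^sup>2)"
          by (simp add: power2_eq_square algebra_simps)
        finally have "(w' x - ?a x)\<^sup>2 + (w x - ?b x)\<^sup>2 \<le> (w x - ?a x)\<^sup>2 + (w' x - ?b x)\<^sup>2"
          by simp
        then show ?thesis using False by (simp add: p_def q_def)
      qed (simp add: p_def q_def)
    qed
  qed (intro Bochner_Integration.integrable_add i)+
  also have "\<dots> = l2sq M w ?a + l2sq M w' ?b"
    unfolding l2sq_def by (rule Bochner_Integration.integral_add[OF i(1,2)])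
  finally have "\<alpha> / 2 * (l2sq M p ?a + l2sq M q ?b) \<le> \<alpha> / 2 * (l2sq M w ?a + l2sq M w' ?b)"
    using \<alpha> by (intro mult_left_mono) auto
  then have "\<alpha> / 2 * l2sq M p ?a + \<alpha> / 2 * l2sq M q ?b \<le> \<alpha> / 2 * l2sq M w ?a + \<alpha> / 2 * l2sq M w' ?b"
    by (simp only: distrib_left)
  then have norms: "ennreal (\<alpha> / 2 * l2sq M p ?a) + ennreal (\<alpha> / 2 * l2sq M q ?b)
      \<le> ennreal (\<alpha> / 2 * l2sq M w ?a) + ennreal (\<alpha> / 2 * l2sq M w' ?b)"
    using \<alpha> by (simp add: ennreal_plus[symmetric] del: ennreal_plus)
  have "objective \<alpha> u' w' + objective \<alpha> u p \<le> objective \<alpha> u' q + objective \<alpha> u p"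
    unfolding w'_def by (intro add_right_mono resolvent_minimal u' \<alpha> L)
  also have "\<dots> = (E p + E q) + (ennreal (\<alpha> / 2 * l2sq M p ?a) + ennreal (\<alpha> / 2 * l2sq M q ?b))"
    unfolding objective_def by (simp only: add_ac)
  also have "\<dots> \<le> (E w + E w') + (ennreal (\<alpha> / 2 * l2sq M w ?a) + ennreal (\<alpha> / 2 * l2sq M w' ?b))"
    unfolding p_def q_def by (intro add_mono E_min_max L norms[unfolded p_def q_def])
  also have "\<dots> = objective \<alpha> u' w' + objective \<alpha> u w"
    unfolding objective_def by (simp only: add_ac)
  finally have "objective \<alpha> u p \<le> objective \<alpha> u w"
    using resolvent_objective_finite[OF u' \<alpha>] unfolding w'_def
    by (simp only: ennreal_add_left_cancel_le) auto
  then have "AE x in M. p x = w x"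
    unfolding w_def by (rule resolvent_unique[OF u \<alpha> L(3)])
  then show ?thesis
    by eventually_elim (simp add: p_def w_def w'_def)
qed

text \<open>\<sigma>-finiteness provides a strictly positive p in L2. Since p never vanishes, min(f,
  n p) equals f at each point from some n on.\<close>

lemma L2_exhaustion:
  assumes f: "f \<in> borel_measurable M" "\<And>x. 0 \<le> f x"
  obtains us where "\<And>n. us n \<in> L2 M" "\<And>n x. 0 \<le> us n x" "\<And>x. incseq (\<lambda>n. us n x)"
    "\<And>x. (\<lambda>n. us n x) \<longlonglongrightarrow> f x"
proof -
  obtain p :: "'a \<Rightarrow> real" where p: "p \<in> borel_measurable M" "\<And>x. p x > 0" "integrable M p"
    and pL: "p \<in> L2 M"
    using positive_integrable_L2_function by blast
  define us where "us n x = min (f x) (real n * p x)" for n x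
  show thesis
  proof (rule that[of us])
    show "us n \<in> L2 M" for n
    proof (rule L2_dominated[OF L2_cmult[OF pL, of "real n"]])
      show "us n \<in> borel_measurable M" unfolding us_def using f p by measurable
      show "AE x in M. \<bar>us n x\<bar> \<le> \<bar>real n * p x\<bar>"
        using f(2) p(2) by (intro AE_I2) (simp add: us_def min_def less_imp_le)
    qed
    show "0 \<le> us n x" for n x using f(2) p(2) by (simp add: us_def less_imp_le)
    show "incseq (\<lambda>n. us n x)" for x
      unfolding us_def incseq_def using p(2)[of x]
      by (intro allI impI min.mono mult_right_mono) (auto simp: less_imp_le)
    show "(\<lambda>n. us n x) \<longlonglongrightarrow> f x" for x
    proof (rule tendsto_eventually)
      obtain N :: nat where N: "f x / p x < real N" using reals_Archimedean2 by blast
      show "\<forall>\<^sub>F n in sequentially. us n x = f x"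
      proof (rule eventually_sequentiallyI)
        fix n assume "n \<ge> N"
        then have "f x / p x < real n" using N by simp
        then show "us n x = f x" using p(2)[of x] by (simp add: us_def field_simps)
      qed
    qed
  qed
qed

lemma resolvent_incseq_AE:
  assumes us: "\<And>n. us n \<in> L2 M" "\<And>x. incseq (\<lambda>n. us n x)" and \<alpha>: "\<alpha> > 0"
  shows "AE x in M. incseq (\<lambda>n. resolvent M E \<alpha> (us n) x)"
proof -
  have "AE x in M. \<forall>n. resolvent M E \<alpha> (us n) x \<le> resolvent M E \<alpha> (us (Suc n)) x"
    unfolding AE_all_countable using us by (intro allI resolvent_mono \<alpha>) (auto simp: incseq_Suc_iff)
  then show ?thesis by (simp add: incseq_Suc_iff)
qed

text \<open>Monotonicity of resolvents supplies the limits that make the choice in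
  \<open>resolvent_ext\<close> meaningful. The sequence obtained is the one attached to the chosen
  value and may differ from that of \<open>L2_exhaustion\<close>; later arguments use only its
  monotone convergence to f.\<close>

lemma resolvent_ext_witness:
  assumes f: "f \<in> borel_measurable M" "\<And>x. 0 \<le> f x" and \<alpha>: "\<alpha> > 0"
  obtains us where "\<And>n. us n \<in> L2 M" "\<And>n x. 0 \<le> us n x" "\<And>x. incseq (\<lambda>n. us n x)"
    "\<And>x. (\<lambda>n. us n x) \<longlonglongrightarrow> f x"
    "AE x in M. (\<lambda>n. ennreal (resolvent M E \<alpha> (us n) x)) \<longlonglongrightarrow> resolvent_ext M E \<alpha> f x"
proof -
  obtain us where us: "\<And>n. us n \<in> L2 M" "\<And>n x. 0 \<le> us n x" "\<And>x. incseq (\<lambda>n. us n x)"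
      "\<And>x. (\<lambda>n. us n x) \<longlonglongrightarrow> f x"
    using L2_exhaustion[OF f] by metis
  have "AE x in M. (\<lambda>n. ennreal (resolvent M E \<alpha> (us n) x)) \<longlonglongrightarrow> (SUP n. ennreal (resolvent M E \<alpha> (us n) x))"
    using resolvent_incseq_AE[OF us(1,3) \<alpha>]
  proof eventually_elim
    case (elim x)
    then show ?case by (intro LIMSEQ_SUP) (auto simp: incseq_def intro: ennreal_leI)
  qed
  with us have "\<exists>v us. (\<forall>n. us n \<in> L2 M \<and> (\<forall>x. 0 \<le> us n x)) \<and>
     (\<forall>x. incseq (\<lambda>n. us n x)) \<and> (\<forall>x. (\<lambda>n. us n x) \<longlonglongrightarrow> f x) \<and>
     (AE x in M. (\<lambda>n. ennreal (resolvent M E \<alpha> (us n) x)) \<longlonglongrightarrow> v x)"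
    by (intro exI[of _ "\<lambda>x. SUP n. ennreal (resolvent M E \<alpha> (us n) x)"] exI[of _ us]) auto
  from someI_ex[OF this] show thesis
    using that unfolding resolvent_ext_def by blast
qed

text \<open>Reduction to resolvents of L2 functions: all approximants of \<alpha> h from below stay
  under \<alpha> h, and a common bound by h passes to the limit defining
  \<open>resolvent_ext\<close>.\<close>

lemma excessiveI:
  assumes h: "h \<in> borel_measurable M" "\<And>x. 0 \<le> h x"
    and le: "\<And>\<alpha> u. \<alpha> > 0 \<Longrightarrow> u \<in> L2 M \<Longrightarrow> (\<And>x. 0 \<le> u x) \<Longrightarrow> (\<And>x. u x \<le> \<alpha> * h x) \<Longrightarrow>
      AE x in M. resolvent M E \<alpha> u x \<le> h x"
  shows "excessive M E h"
  unfolding excessive_def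
proof (intro conjI allI impI h)
  fix \<alpha> :: real assume \<alpha>: "\<alpha> > 0"
  obtain us where us: "\<And>n. us n \<in> L2 M" "\<And>n x. 0 \<le> us n x" "\<And>x. incseq (\<lambda>n. us n x)"
      "\<And>x. (\<lambda>n. us n x) \<longlonglongrightarrow> \<alpha> * h x"
    and lim: "AE x in M. (\<lambda>n. ennreal (resolvent M E \<alpha> (us n) x)) \<longlonglongrightarrow> resolvent_ext M E \<alpha> (\<lambda>x. \<alpha> * h x) x"
  proof (rule resolvent_ext_witness[of "\<lambda>x. \<alpha> * h x" \<alpha>])
    show "(\<lambda>x. \<alpha> * h x) \<in> borel_measurable M" using h by simp
    show "0 \<le> \<alpha> * h x" for x using h(2) \<alpha> by simp
  qed (use \<alpha> in auto)
  have "us n x \<le> \<alpha> * h x" for n x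
    using incseq_le[OF us(3,4)] .
  then have "AE x in M. \<forall>n. resolvent M E \<alpha> (us n) x \<le> h x"
    unfolding AE_all_countable using us \<alpha> by (intro allI le) auto
  with lim show "AE x in M. resolvent_ext M E \<alpha> (\<lambda>y. \<alpha> * h y) x \<le> ennreal (h x)"
    by eventually_elim (auto intro!: LIMSEQ_le_const2 ennreal_leI)
qed

end

section \<open>The extended form\<close>

lemma AE_tendsto_imp_loc_meas_conv:
  assumes [measurable]: "\<And>n. fs n \<in> borel_measurable M" "f \<in> borel_measurable M"
    and lim: "AE x in M. (\<lambda>n. fs n x) \<longlonglongrightarrow> f x"
  shows "loc_meas_conv M fs f"
  unfolding loc_meas_conv_def
proof (intro ballI impI allI)
  fix A and e :: real
  assume [measurable]: "A \<in> sets M" and A: "emeasure M A < \<infinity>" and e: "0 < e"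
  let ?B = "\<lambda>n. {x\<in>A. e < \<bar>fs n x - f x\<bar>}"
  have B: "?B n \<in> sets M" for n
  proof -
    have "?B n = A \<inter> {x\<in>space M. e < \<bar>fs n x - f x\<bar>}"
      using sets.sets_into_space[OF \<open>A \<in> sets M\<close>] by auto
    also have "\<dots> \<in> sets M" by measurable
    finally show ?thesis .
  qed
  have "(\<lambda>n. \<integral>\<^sup>+x. indicator (?B n) x \<partial>M) \<longlonglongrightarrow> (\<integral>\<^sup>+x. 0 \<partial>M)"
  proof (rule nn_integral_dominated_convergence)
    show "(\<integral>\<^sup>+x. indicator A x \<partial>M) < \<infinity>" using A by simp
    show "AE x in M. (\<lambda>n. indicator (?B n) x :: ennreal) \<longlonglongrightarrow> 0"
      using lim
    proof eventually_elim
      case (elim x)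
      then have "\<forall>\<^sub>F n in sequentially. \<bar>fs n x - f x\<bar> < e"
        using e tendstoD[of "\<lambda>n. fs n x" "f x" sequentially e] by (simp add: dist_real_def)
      then show ?case
        by (intro tendsto_eventually) (auto elim!: eventually_mono simp: indicator_def)
    qed
  qed (use B in \<open>auto simp: indicator_def\<close>)
  then show "(\<lambda>n. emeasure M (?B n)) \<longlonglongrightarrow> 0"
    using B by simp
qed

lemma loc_meas_conv_cong_AE:
  assumes [measurable]: "\<And>n. fs n \<in> borel_measurable M" "f \<in> borel_measurable M" "g \<in> borel_measurable M"
    and eq: "AE x in M. f x = g x" and "loc_meas_conv M fs f"
  shows "loc_meas_conv M fs g"
  unfolding loc_meas_conv_def
proof (intro ballI impI allI)
  fix A and e :: real
  assume A: "A \<in> sets M" "emeasure M A < \<infinity>" and e: "0 < e"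
  have B: "{x\<in>A. e < \<bar>fs n x - k x\<bar>} \<in> sets M" if [measurable]: "k \<in> borel_measurable M" for n k
  proof -
    have "{x\<in>A. e < \<bar>fs n x - k x\<bar>} = A \<inter> {x\<in>space M. e < \<bar>fs n x - k x\<bar>}"
      using sets.sets_into_space[OF \<open>A \<in> sets M\<close>] by auto
    also have "\<dots> \<in> sets M" using A by measurable
    finally show ?thesis .
  qed
  have "emeasure M {x\<in>A. e < \<bar>fs n x - f x\<bar>} = emeasure M {x\<in>A. e < \<bar>fs n x - g x\<bar>}" for n
    using eq by (intro emeasure_eq_AE B) auto
  moreover have "(\<lambda>n. emeasure M {x\<in>A. e < \<bar>fs n x - f x\<bar>}) \<longlonglongrightarrow> 0"
    using assms(5) A e unfolding loc_meas_conv_def by blast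
  ultimately show "(\<lambda>n. emeasure M {x\<in>A. e < \<bar>fs n x - g x\<bar>}) \<longlonglongrightarrow> 0"
    by (simp only:)
qed

context order_preserving_form
begin

lemma Ee_cong_AE:
  assumes f: "f \<in> L0 M" and g: "g \<in> L0 M" and eq: "AE x in M. f x = g x"
  shows "Ee M E f = Ee M E g"
proof -
  have "loc_meas_conv M fs f \<longleftrightarrow> loc_meas_conv M fs g" if "\<forall>n. fs n \<in> L0 M" for fs
  proof
    have eq': "AE x in M. g x = f x" using eq by eventually_elim simp
    show "loc_meas_conv M fs f \<Longrightarrow> loc_meas_conv M fs g"
      using that f g eq loc_meas_conv_cong_AE[of fs M f g] by (auto simp: L0_def)
    show "loc_meas_conv M fs g \<Longrightarrow> loc_meas_conv M fs f"
      using that f g eq' loc_meas_conv_cong_AE[of fs M g f] by (auto simp: L0_def)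
  qed
  then have "{liminf (\<lambda>n. Ebar M E (fs n)) | fs. (\<forall>n. fs n \<in> L0 M) \<and> loc_meas_conv M fs f}
      = {liminf (\<lambda>n. Ebar M E (fs n)) | fs. (\<forall>n. fs n \<in> L0 M) \<and> loc_meas_conv M fs g}"
    by blast
  then show ?thesis unfolding Ee_def by simp
qed

lemma Ee_le_liminf:
  assumes \<phi>: "\<And>n. \<phi> n \<in> L2 M" and "f \<in> L0 M" and lim: "AE x in M. (\<lambda>n. \<phi> n x) \<longlonglongrightarrow> f x"
  shows "Ee M E f \<le> liminf (\<lambda>n. E (\<phi> n))"
proof -
  have "loc_meas_conv M \<phi> f"
    using assms by (intro AE_tendsto_imp_loc_meas_conv) (auto simp: L0_def L2_def)
  then have "Ee M E f \<le> liminf (\<lambda>n. Ebar M E (\<phi> n))"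
    unfolding Ee_def using \<phi> by (intro Inf_lower) (auto simp: L0_def L2_def)
  then show ?thesis using \<phi> by (simp add: Ebar_def)
qed

text \<open>Approximate \<open>f n\<close> up to 2^-n on \<open>X n\<close> outside a set of measure
  2^-n, then apply Borel-Cantelli; every point lies in \<open>X n\<close> for all large n. The
  target may vary with n, so a minimising sequence for \<open>Ee\<close> can be moved into L2 at
  once, and a constant target gives an ordinary recovery sequence.\<close>

lemma Ee_recovery:
  assumes f: "\<And>n. f n \<in> L0 M" and c: "\<And>n. Ee M E (f n) < c n"
  obtains \<phi> where "\<And>n. \<phi> n \<in> L2 M" "\<And>n. E (\<phi> n) < c n" "AE x in M. (\<lambda>n. \<phi> n x - f n x) \<longlonglongrightarrow> 0"
proof -
  obtain X :: "nat \<Rightarrow> 'a set" where X: "range X \<subseteq> sets M" "(\<Union>i. X i) = space M"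
      "\<And>i. emeasure M (X i) \<noteq> \<infinity>" "incseq X"
    using sigma_finite_incseq by metis
  have [measurable]: "f n \<in> borel_measurable M" for n using f by (simp add: L0_def)
  have [measurable]: "X n \<in> sets M" for n using X(1) by auto
  have "\<exists>\<phi>. \<phi> \<in> L2 M \<and> E \<phi> < c n \<and> emeasure M {x\<in>X n. (1/2)^n < \<bar>\<phi> x - f n x\<bar>} < ennreal ((1/2)^n)" for n
  proof -
    obtain fs where fs: "\<forall>k. fs k \<in> L0 M" "loc_meas_conv M fs (f n)"
        and lt: "liminf (\<lambda>k. Ebar M E (fs k)) < c n"
      using c[of n] unfolding Ee_def Inf_less_iff by blast
    have "(\<lambda>k. emeasure M {x\<in>X n. (1/2)^n < \<bar>fs k x - f n x\<bar>}) \<longlonglongrightarrow> 0"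
      using fs(2) X(3)[of n] unfolding loc_meas_conv_def by (auto simp: less_top)
    then have ev: "\<forall>\<^sub>F k in sequentially. emeasure M {x\<in>X n. (1/2)^n < \<bar>fs k x - f n x\<bar>} < ennreal ((1/2)^n)"
      by (rule order_tendstoD(2)) simp
    have "\<exists>\<^sub>F k in sequentially. Ebar M E (fs k) < c n"
    proof (rule ccontr)
      assume "\<not> ?thesis"
      then have "\<forall>\<^sub>F k in sequentially. c n \<le> Ebar M E (fs k)"
        by (simp add: not_frequently not_less)
      then have "c n \<le> liminf (\<lambda>k. Ebar M E (fs k))" by (rule Liminf_bounded)
      with lt show False by simp
    qed
    \<comment> \<open>The limes inferior gives small energy only for infinitely many k, whereas
      closeness in measure holds eventually, so a common k exists. Its energy is below
      \<open>c n\<close>, which rules out the infinite branch of \<open>Ebar\<close> and puts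
      \<open>fs k\<close> into L2.\<close>
    from frequently_ex[OF frequently_eventually_conj[OF this ev]]
    obtain k where k: "emeasure M {x\<in>X n. (1/2)^n < \<bar>fs k x - f n x\<bar>} < ennreal ((1/2)^n)"
        "Ebar M E (fs k) < c n" by blast
    then have "fs k \<in> L2 M" "E (fs k) < c n" by (auto simp: Ebar_def split: if_splits)
    with k show ?thesis by blast
  qed
  then have "\<exists>\<phi>. \<forall>n. \<phi> n \<in> L2 M \<and> E (\<phi> n) < c n
      \<and> emeasure M {x\<in>X n. (1/2)^n < \<bar>\<phi> n x - f n x\<bar>} < ennreal ((1/2)^n)"
    by (intro choice allI)
  then obtain \<phi> where \<phi>: "\<And>n. \<phi> n \<in> L2 M" "\<And>n. E (\<phi> n) < c n"
    "\<And>n. emeasure M {x\<in>X n. (1/2)^n < \<bar>\<phi> n x - f n x\<bar>} < ennreal ((1/2)^n)" by blast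
  define B where "B n = {x\<in>X n. (1/2)^n < \<bar>\<phi> n x - f n x\<bar>}" for n
  have [measurable]: "\<phi> n \<in> borel_measurable M" for n using \<phi>(1) by (simp add: L2_def)
  have B: "B n \<in> sets M" for n
  proof -
    have "B n = X n \<inter> {x\<in>space M. (1/2)^n < \<bar>\<phi> n x - f n x\<bar>}"
      using X(2) by (auto simp: B_def)
    also have "\<dots> \<in> sets M" by measurable
    finally show ?thesis .
  qed
  have Bfin: "emeasure M (B n) < \<infinity>" for n
    using \<phi>(3)[of n] by (auto simp: B_def intro: less_trans)
  have "summable (\<lambda>n. measure M (B n))"
  proof (rule summable_comparison_test)
    have "measure M (B n) \<le> (1/2)^n" for n
      using \<phi>(3)[of n] unfolding measure_def by (intro enn2real_leI) (auto simp: B_def)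
    then show "\<exists>N. \<forall>n\<ge>N. norm (measure M (B n)) \<le> (1/2)^n" by simp
  qed (simp add: summable_geometric)
  from borel_cantelli_AE1[OF B Bfin this] have "AE x in M. (\<lambda>n. \<phi> n x - f n x) \<longlonglongrightarrow> 0"
  proof (eventually_elim)
    case (elim x)
    then obtain N where N: "\<And>n. n \<ge> N \<Longrightarrow> x \<in> space M - B n"
      by (auto simp: eventually_sequentially)
    obtain K where K: "x \<in> X K" using N[of N] X(2) by auto
    have "\<forall>\<^sub>F n in sequentially. norm (\<phi> n x - f n x) \<le> (1/2)^n"
    proof (rule eventually_sequentiallyI)
      fix n assume n: "n \<ge> max N K"
      then have "x \<in> X n" using K X(4) by (auto simp: incseq_def)
      then show "norm (\<phi> n x - f n x) \<le> (1/2)^n" using N[of n] n by (auto simp: B_def)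
    qed
    then show ?case
      by (rule Lim_null_comparison) (simp add: LIMSEQ_power_zero)
  qed
  with \<phi> that show thesis by blast
qed

text \<open>The minimum of \<open>h\<close> with a resolvent \<open>w\<close> has no larger energy than \<open>w\<close>, because the maximum
  competes with \<open>h\<close>; being closer to \<open>u / \<alpha>\<close> it would beat \<open>w\<close> unless \<open>w \<le> h\<close>.\<close>
lemma minimizer_excessive:
  assumes h: "h \<in> L0 M" "\<And>x. 0 \<le> h x" "Ee M E h < \<infinity>"
    and min: "\<And>f. f \<in> L0 M \<Longrightarrow> (\<And>x. h x \<le> f x) \<Longrightarrow> Ee M E h \<le> Ee M E f"
  shows "excessive M E h"
proof (rule excessiveI)
  show hm[measurable]: "h \<in> borel_measurable M" using h by (simp add: L0_def)
  fix \<alpha> :: real and u assume \<alpha>: "\<alpha> > 0" and u: "u \<in> L2 M" "\<And>x. 0 \<le> u x" "\<And>x. u x \<le> \<alpha> * h x"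
  define w where "w = resolvent M E \<alpha> u"
  have w: "w \<in> L2 M" using u \<alpha> by (auto simp: w_def intro: resolvent_L2)
  note [measurable] = L2_measurable[OF w]
  define p where "p x = min (w x) (h x)" for x
  have pL: "p \<in> L2 M"
  proof (rule L2_dominated[OF w])
    show "p \<in> borel_measurable M" unfolding p_def by measurable
    show "AE x in M. \<bar>p x\<bar> \<le> \<bar>w x\<bar>" using h(2) by (intro AE_I2) (auto simp: p_def min_def)
  qed
  obtain \<phi> where \<phi>: "\<And>n. \<phi> n \<in> L2 M" "\<And>n. E (\<phi> n) < Ee M E h + ennreal (1 / real (Suc n))"
      "AE x in M. (\<lambda>n. \<phi> n x - h x) \<longlonglongrightarrow> 0"
    using Ee_recovery[of "\<lambda>n. h" "\<lambda>n. Ee M E h + ennreal (1 / real (Suc n))"]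
      h(1) less_add_inverse_Suc[OF h(3)] by blast
  \<comment> \<open>Truncation at 0 costs no energy and gives |min(w, \<psi>)| \<le> |w|. This
    domination turns almost everywhere convergence of the minima into convergence in L2, as lower
    semicontinuity of \<open>E\<close> requires.\<close>
  define \<psi> where "\<psi> n x = max 0 (\<phi> n x)" for n x
  have \<psi>L: "\<psi> n \<in> L2 M" for n
    using L2_max[OF L2_zero \<phi>(1)[of n]] by (simp add: \<psi>_def[abs_def])
  have \<psi>E: "E (\<psi> n) \<le> Ee M E h + ennreal (1 / real (Suc n))" for n
    using E_max_zero_le[OF \<phi>(1)[of n]] \<phi>(2)[of n] by (auto simp: \<psi>_def[abs_def])
  have \<psi>lim: "AE x in M. (\<lambda>n. \<psi> n x) \<longlonglongrightarrow> h x"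
    using \<phi>(3)
  proof eventually_elim
    case (elim x)
    then have "(\<lambda>n. max 0 (\<phi> n x)) \<longlonglongrightarrow> max 0 (h x)"
      by (intro tendsto_max tendsto_const) (simp add: LIM_zero_iff)
    then show ?case using h(2)[of x] by (simp add: \<psi>_def)
  qed
  note [measurable] = L2_measurable[OF \<psi>L]
  have mL: "(\<lambda>x. min (w x) (\<psi> n x)) \<in> L2 M" "(\<lambda>x. max (w x) (\<psi> n x)) \<in> L2 M" for n
    using w \<psi>L by (auto intro: L2_intros)
  have minlim: "(\<lambda>n. l2sq M (\<lambda>x. min (w x) (\<psi> n x)) p) \<longlonglongrightarrow> 0"
  proof (rule l2sq_dominated_convergence(2)[OF L2_abs[OF w]])
    show "AE x in M. \<bar>min (w x) (\<psi> n x)\<bar> \<le> \<bar>w x\<bar>" for n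
      by (intro AE_I2) (auto simp: \<psi>_def min_def max_def)
    show "AE x in M. (\<lambda>n. min (w x) (\<psi> n x)) \<longlonglongrightarrow> p x"
      using \<psi>lim by eventually_elim (auto simp: p_def intro!: tendsto_min)
    show "p \<in> borel_measurable M" using pL by (rule L2_measurable)
  qed measurable
  have "Ee M E h \<le> Ee M E (\<lambda>x. max (w x) (h x))"
    by (rule min) (auto simp: L0_def)
  also have "\<dots> \<le> liminf (\<lambda>n. E (\<lambda>x. max (w x) (\<psi> n x)))"
  proof (rule Ee_le_liminf[OF mL(2)])
    show "AE x in M. (\<lambda>n. max (w x) (\<psi> n x)) \<longlonglongrightarrow> max (w x) (h x)"
      using \<psi>lim by eventually_elim (auto intro!: tendsto_max)
  qed (simp add: L0_def)
  finally have "Ee M E h + E p \<le> liminf (\<lambda>n. E (\<lambda>x. max (w x) (\<psi> n x))) + liminf (\<lambda>n. E (\<lambda>x. min (w x) (\<psi> n x)))"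
    by (intro add_mono E_lsc[OF mL(1) pL minlim])
  also have "\<dots> \<le> liminf (\<lambda>n. E (\<lambda>x. max (w x) (\<psi> n x)) + E (\<lambda>x. min (w x) (\<psi> n x)))"
    by (rule ennreal_liminf_add_le)
  also have "\<dots> \<le> liminf (\<lambda>n. (Ee M E h + E w) + ennreal (1 / real (Suc n)))"
  proof (intro Liminf_mono always_eventually allI)
    fix n
    have "E (\<lambda>x. max (w x) (\<psi> n x)) + E (\<lambda>x. min (w x) (\<psi> n x)) \<le> E w + E (\<psi> n)"
      using E_min_max[OF w \<psi>L[of n]] by (simp add: add.commute)
    also have "\<dots> \<le> E w + (Ee M E h + ennreal (1 / real (Suc n)))"
      by (intro add_left_mono \<psi>E)
    finally show "E (\<lambda>x. max (w x) (\<psi> n x)) + E (\<lambda>x. min (w x) (\<psi> n x))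
        \<le> (Ee M E h + E w) + ennreal (1 / real (Suc n))"
      by (simp only: add_ac)
  qed
  also have "\<dots> = Ee M E h + E w"
    by (rule lim_imp_Liminf[OF sequentially_bot tendsto_add_inverse_Suc])
  finally have Ep: "E p \<le> E w"
    using h(3) by (simp only: ennreal_add_left_cancel_le) auto
  let ?v = "\<lambda>x. u x / \<alpha>"
  have v: "?v \<in> L2 M" using u(1) by (rule L2_divide)
  have "l2sq M p ?v \<le> l2sq M w ?v"
    unfolding l2sq_def
  proof (intro integral_mono l2sq_integrable pL w v)
    fix x
    have "?v x \<le> h x" using u(3)[of x] \<alpha> by (simp add: field_simps)
    then have "\<bar>p x - ?v x\<bar> \<le> \<bar>w x - ?v x\<bar>" by (auto simp: p_def min_def)
    then show "(p x - ?v x)\<^sup>2 \<le> (w x - ?v x)\<^sup>2" by (simp only: abs_le_square_iff)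
  qed
  then have "objective \<alpha> u p \<le> objective \<alpha> u w"
    unfolding objective_def using \<alpha> by (intro add_mono Ep ennreal_leI mult_left_mono) auto
  then have "AE x in M. p x = w x"
    unfolding w_def by (intro resolvent_unique u \<alpha> pL)
  then show "AE x in M. resolvent M E \<alpha> u x \<le> h x"
    by eventually_elim (simp add: p_def w_def)
qed (rule h(2))

end

section \<open>Existence of minimizers\<close>

lemma ennreal_eq_inftyI:
  assumes "\<And>K. ennreal K \<le> l" shows "l = \<infinity>"
proof (cases l)
  case (real r)
  then show ?thesis using assms[of "r + 1"] by (simp add: ennreal_le_iff)
qed simp

text \<open>Convergence of exp(-a/2) leaves for a only a finite limit or the limit +\<infinity>; a
  finite limes inferior excludes the latter.\<close>

lemma convergent_of_exp:
  fixes a :: "nat \<Rightarrow> real"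
  assumes conv: "convergent (\<lambda>n. exp (- a n / 2))" and fin: "liminf (\<lambda>n. ennreal (a n)) < \<infinity>"
  shows "convergent a"
proof -
  obtain y where y: "(\<lambda>n. exp (- a n / 2)) \<longlonglongrightarrow> y" using conv by (auto simp: convergent_def)
  have y0: "y \<ge> 0" by (rule LIMSEQ_le_const[OF y]) auto
  show ?thesis
  proof (cases "y = 0")
    case False
    then have "(\<lambda>n. - 2 * ln (exp (- a n / 2))) \<longlonglongrightarrow> - 2 * ln y"
      by (intro tendsto_intros y)
    then show ?thesis by (auto simp: convergent_def)
  next
    case True
    have "ennreal K \<le> liminf (\<lambda>n. ennreal (a n))" for K
    proof (rule Liminf_bounded)
      have "\<forall>\<^sub>F n in sequentially. exp (- a n / 2) < exp (- K / 2)"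
        using y True by (intro order_tendstoD(2)) auto
      then show "\<forall>\<^sub>F n in sequentially. ennreal K \<le> ennreal (a n)"
        by eventually_elim (auto intro!: ennreal_leI)
    qed
    then have "liminf (\<lambda>n. ennreal (a n)) = \<infinity>"
      by (rule ennreal_eq_inftyI)
    with fin show ?thesis by simp
  qed
qed

text \<open>Up to convex combinations, a sequence of nonnegative measurable functions converges in
  \<open>[0,\<infinity>]\<close>: the strictly convex functional \<open>f \<mapsto> \<integral> p exp(-f)\<close> is almost minimised on the tail hulls.\<close>
lemma (in sigma_finite_measure) nonneg_midhull_exp_convergent:
  fixes \<phi> :: "nat \<Rightarrow> 'a \<Rightarrow> real"
  assumes \<phi>: "\<And>k. \<phi> k \<in> borel_measurable M" "\<And>k x. 0 \<le> \<phi> k x"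
  obtains g where "\<And>n. g n \<in> midhull (\<phi> ` {n..})" "AE x in M. convergent (\<lambda>n. exp (- g n x / 2))"
proof -
  obtain p :: "'a \<Rightarrow> real" where p: "p \<in> borel_measurable M" "\<And>x. p x > 0" "\<And>x. p x \<le> 1" "integrable M p"
    using obtain_positive_integrable_function by blast
  note [measurable] = p(1)
  define J where "J f = (\<integral>x. p x * exp (- f x) \<partial>M)" for f
  have int: "integrable M (\<lambda>x. p x * exp (- f x))" if [measurable]: "f \<in> borel_measurable M" and "\<And>x. 0 \<le> f x" for f
  proof (rule Bochner_Integration.integrable_bound[OF p(4)])
    show "AE x in M. norm (p x * exp (- f x)) \<le> norm (p x)"
      using p(2) that(2) by (intro AE_I2) (simp add: abs_mult mult_left_le)
  qed measurable
  have J0: "0 \<le> J f" for f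
    unfolding J_def using p(2) by (intro integral_nonneg_AE AE_I2) (simp add: less_imp_le)
  have JB: "J (\<phi> k) \<le> integral\<^sup>L M p" for k
    unfolding J_def using \<phi> p by (intro integral_mono int) (auto simp: mult_left_le less_imp_le)
  \<comment> \<open>Since exp(-(f+g)/2) is the product of exp(-f/2) and exp(-g/2), the defect is the
    integral of a perfect square. This is where the factor 1/2 in the exponents comes from.\<close>
  have defect: "(J f + J g) / 2 - J (\<lambda>x. (f x + g x) / 2)
      = (\<integral>x. (sqrt (p x) * exp (- f x / 2) - sqrt (p x) * exp (- g x / 2))\<^sup>2 \<partial>M) / 2"
    and defint: "integrable M (\<lambda>x. (sqrt (p x) * exp (- f x / 2) - sqrt (p x) * exp (- g x / 2))\<^sup>2)"
    if f: "f \<in> borel_measurable M" "\<And>x. 0 \<le> f x" and g: "g \<in> borel_measurable M" "\<And>x. 0 \<le> g x" for f g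
  proof -
    have m: "(\<lambda>x. (f x + g x) / 2) \<in> borel_measurable M" "\<And>x. 0 \<le> (f x + g x) / 2"
      using f g by auto
    have eq: "(sqrt (p x) * exp (- f x / 2) - sqrt (p x) * exp (- g x / 2))\<^sup>2
        = p x * exp (- f x) + p x * exp (- g x) - 2 * (p x * exp (- ((f x + g x) / 2)))" for x
    proof -
      have e: "exp (- f x / 2) * exp (- f x / 2) = exp (- f x)" "exp (- g x / 2) * exp (- g x / 2) = exp (- g x)"
        "exp (- f x / 2) * exp (- g x / 2) = exp (- ((f x + g x) / 2))"
        by (simp_all add: exp_add[symmetric] field_simps)
      have "(sqrt (p x) * exp (- f x / 2) - sqrt (p x) * exp (- g x / 2))\<^sup>2
          = (sqrt (p x) * sqrt (p x)) * (exp (- f x / 2) * exp (- f x / 2) + exp (- g x / 2) * exp (- g x / 2)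
            - 2 * (exp (- f x / 2) * exp (- g x / 2)))"
        by (simp only: power2_eq_square) (simp only: algebra_simps)
      also have "sqrt (p x) * sqrt (p x) = p x" using p(2)[of x] by simp
      finally show ?thesis unfolding e by (simp add: algebra_simps)
    qed
    show "integrable M (\<lambda>x. (sqrt (p x) * exp (- f x / 2) - sqrt (p x) * exp (- g x / 2))\<^sup>2)"
      unfolding eq using int[OF f] int[OF g] int[OF m] by auto
    have "(\<integral>x. (sqrt (p x) * exp (- f x / 2) - sqrt (p x) * exp (- g x / 2))\<^sup>2 \<partial>M)
        = J f + J g - 2 * J (\<lambda>x. (f x + g x) / 2)"
      unfolding eq J_def using int[OF f] int[OF g] int[OF m] by simp
    then show "(J f + J g) / 2 - J (\<lambda>x. (f x + g x) / 2)
      = (\<integral>x. (sqrt (p x) * exp (- f x / 2) - sqrt (p x) * exp (- g x / 2))\<^sup>2 \<partial>M) / 2"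
      by simp
  qed
  obtain g where g: "\<And>n. g n \<in> midhull (\<phi> ` {n..})"
    and d: "\<And>e. e > 0 \<Longrightarrow> \<exists>N. \<forall>m\<ge>N. \<forall>n\<ge>N. (J (g m) + J (g n)) / 2 - J (\<lambda>x. (g m x + g n x) / 2) < e"
    using midhull_small_defect[of J \<phi>, OF J0 JB] by blast
  have gm[measurable]: "g n \<in> borel_measurable M" for n
    using \<phi>(1) by (intro midhull_measurable[OF g]) auto
  have g0: "0 \<le> g n x" for n x
    using \<phi>(2) by (intro midhull_ge[OF g]) auto
  \<comment> \<open>The factor sqrt(p) absorbs the weight, so that the unweighted Cauchy lemma
    applies; being positive, it is divided out again at the end.\<close>
  define a where "a n x = sqrt (p x) * exp (- g n x / 2)" for n x
  have "\<exists>N. \<forall>m\<ge>N. \<forall>n\<ge>N. (\<integral>\<^sup>+x. ennreal ((a m x - a n x)\<^sup>2) \<partial>M) \<le> ennreal e" if e: "e > 0" for e :: real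
  proof -
    obtain N where N: "\<forall>m\<ge>N. \<forall>n\<ge>N. (J (g m) + J (g n)) / 2 - J (\<lambda>x. (g m x + g n x) / 2) < e / 2"
      using d[of "e / 2"] e by fastforce
    have "(\<integral>\<^sup>+x. ennreal ((a m x - a n x)\<^sup>2) \<partial>M) \<le> ennreal e" if mn: "m \<ge> N" "n \<ge> N" for m n
    proof -
      have "(\<integral>\<^sup>+x. ennreal ((a m x - a n x)\<^sup>2) \<partial>M) = ennreal (\<integral>x. (a m x - a n x)\<^sup>2 \<partial>M)"
        unfolding a_def by (intro nn_integral_eq_integral defint gm g0) auto
      also have "\<dots> \<le> ennreal e"
        using N[rule_format, OF mn] defect[OF gm g0 gm g0, of m n] by (intro ennreal_leI) (simp add: a_def)
      finally show ?thesis .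
    qed
    then show ?thesis by blast
  qed
  moreover have "a n \<in> borel_measurable M" for n unfolding a_def by measurable
  ultimately obtain r :: "nat \<Rightarrow> nat" where r: "strict_mono r" and conv: "AE x in M. convergent (\<lambda>n. a (r n) x)"
    using square_Cauchy_AE_subseq[of a M] by blast
  show thesis
  proof (rule that[of "\<lambda>n. g (r n)"])
    show "g (r n) \<in> midhull (\<phi> ` {n..})" for n
      using g[of "r n"] seq_suble[OF r, of n] midhull_mono[of "\<phi> ` {r n..}" "\<phi> ` {n..}"]
      by (meson atLeast_subset_iff image_mono subsetD)
    show "AE x in M. convergent (\<lambda>n. exp (- g (r n) x / 2))"
      using conv
    proof eventually_elim
      case (elim x)
      have "convergent (\<lambda>n. a (r n) x / sqrt (p x))"
        using elim unfolding divide_inverse by (intro convergent_mult convergent_const)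
      then show ?case using p(2)[of x] by (simp add: a_def)
    qed
  qed
qed

context order_preserving_form
begin

text \<open>The common interface of the two alternative hypotheses. The bounded subsequence may
  depend on the point; this is enough because the property is applied to sequences along which
  exp(-f/2) already converges almost everywhere.\<close>

definition sublevels_bounded :: bool where
  "sublevels_bounded \<longleftrightarrow> (\<forall>c<\<infinity>. \<forall>\<phi>::nat \<Rightarrow> 'a \<Rightarrow> real.
     (\<forall>n. \<phi> n \<in> L2 M \<and> (\<forall>x. 0 \<le> \<phi> n x) \<and> E (\<phi> n) \<le> c) \<longrightarrow>
     (AE x in M. liminf (\<lambda>n. ennreal (\<phi> n x)) < \<infinity>))"

lemma Ee_minimizer_exists:
  assumes bounded: sublevels_bounded
    and ex: "\<exists>f\<in>DEe M E. AE x in M. x \<in> A \<longrightarrow> g x \<le> f x"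
  obtains h where "h \<in> L0 M" "\<And>x. 0 \<le> h x" "Ee M E h < \<infinity>" "AE x in M. x \<in> A \<longrightarrow> g x \<le> h x"
    "\<And>f. f \<in> L0 M \<Longrightarrow> (AE x in M. x \<in> A \<longrightarrow> g x \<le> f x) \<Longrightarrow> Ee M E h \<le> Ee M E f"
proof -
  define K where "K = {f\<in>L0 M. AE x in M. x \<in> A \<longrightarrow> g x \<le> f x}"
  define m where "m = (INF f\<in>K. Ee M E f)"
  have mfin: "m < \<infinity>"
    using ex unfolding m_def K_def DEe_def by (auto simp: INF_less_iff)
  have "\<exists>f\<in>K. Ee M E f < m + ennreal (1 / real (Suc n))" for n
    using less_add_inverse_Suc[OF mfin, of n] unfolding m_def by (simp add: INF_less_iff)
  then have "\<exists>f. \<forall>n. f n \<in> K \<and> Ee M E (f n) < m + ennreal (1 / real (Suc n))"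
    by (intro choice) blast
  then obtain f where f: "\<And>n. f n \<in> K" "\<And>n. Ee M E (f n) < m + ennreal (1 / real (Suc n))" by blast
  obtain \<phi>' where \<phi>': "\<And>n. \<phi>' n \<in> L2 M" "\<And>n. E (\<phi>' n) < m + ennreal (1 / real (Suc n))"
      "AE x in M. (\<lambda>n. \<phi>' n x - f n x) \<longlonglongrightarrow> 0"
    using Ee_recovery[of f "\<lambda>n. m + ennreal (1 / real (Suc n))"] f by (auto simp: K_def)
  \<comment> \<open>Nonnegativity is needed for the exponential functional and for the sign of h;
    truncation neither raises the energy nor lowers the function below g - e at points where \<phi>'
    is above it.\<close>
  define \<phi> where "\<phi> n = (\<lambda>x. max 0 (\<phi>' n x))" for n
  have \<phi>L: "\<phi> n \<in> L2 M" for n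
    unfolding \<phi>_def by (intro L2_max L2_zero \<phi>')
  have \<phi>E: "E (\<phi> k) \<le> m + ennreal (1 / real (Suc n))" if "k \<ge> n" for n k
  proof -
    have "E (\<phi> k) \<le> m + ennreal (1 / real (Suc k))"
      unfolding \<phi>_def using E_max_zero_le[OF \<phi>'(1)[of k]] \<phi>'(2)[of k] by simp
    also have "\<dots> \<le> m + ennreal (1 / real (Suc n))"
      using that by (intro add_left_mono ennreal_leI) (simp add: field_simps)
    finally show ?thesis .
  qed
  have \<phi>meas: "\<phi> n \<in> borel_measurable M" for n by (rule L2_measurable[OF \<phi>L])
  have \<phi>0: "0 \<le> \<phi> n x" for n x by (simp add: \<phi>_def)
  obtain G where G: "\<And>n. G n \<in> midhull (\<phi> ` {n..})" "AE x in M. convergent (\<lambda>n. exp (- G n x / 2))"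
    using nonneg_midhull_exp_convergent[of \<phi>, OF \<phi>meas \<phi>0] by blast
  have GL: "G n \<in> L2 M" for n using \<phi>L by (intro midhull_L2[OF G(1)]) auto
  have G0: "0 \<le> G n x" for n x using \<phi>0 by (intro midhull_ge[OF G(1)]) auto
  have GE: "E (G n) \<le> m + ennreal (1 / real (Suc n))" for n
    using \<phi>L \<phi>E by (intro midhull_E_le[OF G(1)]) auto
  have "E (G n) \<le> m + 1" for n
    by (rule order_trans[OF GE add_left_mono]) (simp add: ennreal_le_1)
  then have "AE x in M. liminf (\<lambda>n. ennreal (G n x)) < \<infinity>"
    using bounded[unfolded sublevels_bounded_def, rule_format, of "m + 1" G] mfin GL G0
    by (auto simp: less_top[symmetric])
  with G(2) have conv: "AE x in M. convergent (\<lambda>n. G n x)"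
    by eventually_elim (rule convergent_of_exp)
  \<comment> \<open>On the null set without convergence \<open>lim\<close> is an arbitrary value;
    the absolute value makes h nonnegative there too and changes nothing elsewhere.\<close>
  define h where "h x = \<bar>lim (\<lambda>n. G n x)\<bar>" for x
  have [measurable]: "G n \<in> borel_measurable M" for n by (rule L2_measurable[OF GL])
  have hm: "h \<in> L0 M" unfolding h_def L0_def by measurable
  have h0: "0 \<le> h x" for x by (simp add: h_def)
  have lim: "AE x in M. (\<lambda>n. G n x) \<longlonglongrightarrow> h x"
    using conv
  proof eventually_elim
    case (elim x)
    then have "(\<lambda>n. G n x) \<longlonglongrightarrow> lim (\<lambda>n. G n x)" by (simp add: convergent_LIMSEQ_iff)
    from tendsto_rabs[OF this] show ?case using G0 by (simp add: h_def)
  qed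
  have "Ee M E h \<le> liminf (\<lambda>n. E (G n))"
    by (rule Ee_le_liminf[OF GL hm lim])
  also have "\<dots> \<le> liminf (\<lambda>n. m + ennreal (1 / real (Suc n)))"
    by (intro Liminf_mono always_eventually allI GE)
  also have "\<dots> = m"
    by (rule lim_imp_Liminf[OF sequentially_bot tendsto_add_inverse_Suc])
  finally have hE: "Ee M E h \<le> m" .
  have "AE x in M. \<forall>n. x \<in> A \<longrightarrow> g x \<le> f n x"
    unfolding AE_all_countable using f(1) by (auto simp: K_def)
  with lim \<phi>'(3) have hg: "AE x in M. x \<in> A \<longrightarrow> g x \<le> h x"
  proof eventually_elim
    case (elim x)
    show ?case
    proof
      assume x: "x \<in> A"
      \<comment> \<open>The constraint holds for \<open>f n\<close>, and for the L2 approximants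
        only up to an error tending to 0. At a fixed point the lower bound g x - e holds on a whole
        tail, hence on its hull and in the limit.\<close>
      show "g x \<le> h x"
      proof (rule field_le_epsilon)
        fix e :: real assume e: "0 < e"
        obtain N where N: "\<And>n. n \<ge> N \<Longrightarrow> \<bar>\<phi>' n x - f n x\<bar> < e"
          using LIMSEQ_D[OF elim(2) e] by auto
        have "g x - e \<le> G n x" if n: "n \<ge> N" for n
        proof (rule midhull_ge[OF G(1)])
          fix k assume "k \<in> \<phi> ` {n..}"
          then obtain j where j: "k = \<phi> j" "j \<ge> n" by auto
          then have "\<bar>\<phi>' j x - f j x\<bar> < e" "g x \<le> f j x" using N[of j] n elim(3) x by auto
          then show "g x - e \<le> k x" by (simp add: j \<phi>_def)
        qed
        then have "g x - e \<le> h x" by (intro LIMSEQ_le_const[OF elim(1)]) auto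
        then show "g x \<le> h x + e" by simp
      qed
    qed
  qed
  show thesis
  proof (rule that[OF hm h0 _ hg])
    show "Ee M E h < \<infinity>" using hE mfin by (rule le_less_trans)
    fix k assume "k \<in> L0 M" "AE x in M. x \<in> A \<longrightarrow> g x \<le> k x"
    then have "m \<le> Ee M E k" unfolding m_def by (intro INF_lower) (simp add: K_def)
    with hE show "Ee M E h \<le> Ee M E k" by simp
  qed
qed

text \<open>Any function above h satisfies the obstacle condition again, so h has least energy among
  the functions above itself, which is the condition in \<open>minimizer_excessive\<close>.\<close>

lemma excessive_minimizer_exists:
  assumes bounded: sublevels_bounded
    and ex: "\<exists>f\<in>DEe M E. AE x in M. x \<in> A \<longrightarrow> g x \<le> f x"
  obtains h where "excessive M E h" "h \<in> DEe M E" "AE x in M. x \<in> A \<longrightarrow> g x \<le> h x"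
    "\<And>f. f \<in> L0 M \<Longrightarrow> (AE x in M. x \<in> A \<longrightarrow> g x \<le> f x) \<Longrightarrow> Ee M E h \<le> Ee M E f"
proof -
  obtain h where h: "h \<in> L0 M" "\<And>x. 0 \<le> h x" "Ee M E h < \<infinity>" "AE x in M. x \<in> A \<longrightarrow> g x \<le> h x"
    "\<And>f. f \<in> L0 M \<Longrightarrow> (AE x in M. x \<in> A \<longrightarrow> g x \<le> f x) \<Longrightarrow> Ee M E h \<le> Ee M E f"
    using Ee_minimizer_exists[OF assms] by blast
  have "excessive M E h"
  proof (rule minimizer_excessive[OF h(1-3)])
    fix f assume f: "f \<in> L0 M" "\<And>x. h x \<le> f x"
    have "AE x in M. x \<in> A \<longrightarrow> g x \<le> f x"
      using h(4) by eventually_elim (use f(2) in \<open>auto intro: order_trans\<close>)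
    then show "Ee M E h \<le> Ee M E f" by (rule h(5)[OF f(1)])
  qed
  with h that show thesis by (auto simp: DEe_def)
qed

lemma positive_excessive_exists:
  assumes bounded: sublevels_bounded
    and ex: "\<exists>g\<in>DEe M E. AE x in M. 0 < g x"
  shows "\<exists>h. excessive M E h \<and> (\<forall>x. 0 < h x)"
proof -
  obtain g where g: "g \<in> DEe M E" "AE x in M. 0 < g x" using ex by blast
  obtain h where h: "h \<in> L0 M" "\<And>x. 0 \<le> h x" "Ee M E h < \<infinity>" "AE x in M. x \<in> UNIV \<longrightarrow> g x \<le> h x"
    "\<And>f. f \<in> L0 M \<Longrightarrow> (AE x in M. x \<in> UNIV \<longrightarrow> g x \<le> f x) \<Longrightarrow> Ee M E h \<le> Ee M E f"
    using Ee_minimizer_exists[OF bounded, of UNIV g] g(1) by blast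
  \<comment> \<open>With the whole space as obstacle set, h \<ge> g > 0 holds almost everywhere.
    Resetting h to 1 on the remaining null set makes it positive everywhere and keeps both its
    energy and its minimality.\<close>
  define k where "k x = (if 0 < h x then h x else 1)" for x
  have [measurable]: "h \<in> borel_measurable M" using h(1) by (simp add: L0_def)
  have k: "k \<in> L0 M" "\<And>x. 0 < k x" unfolding L0_def k_def by auto
  have eq: "AE x in M. k x = h x" using g(2) h(4) by eventually_elim (simp add: k_def)
  have Ek: "Ee M E k = Ee M E h" by (rule Ee_cong_AE[OF k(1) h(1) eq])
  have "excessive M E k"
  proof (rule minimizer_excessive[OF k(1)])
    fix f assume f: "f \<in> L0 M" "\<And>x. k x \<le> f x"
    have "AE x in M. x \<in> UNIV \<longrightarrow> g x \<le> f x"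
      using h(4) eq by eventually_elim (use f(2) in \<open>metis order_trans\<close>)
    then show "Ee M E k \<le> Ee M E f" unfolding Ek by (rule h(5)[OF f(1)])
  qed (use k Ek h in \<open>auto simp: less_imp_le\<close>)
  with k show ?thesis by blast
qed

end

section \<open>Subcritical forms\<close>

lemma liminf_ennreal_finite_scale:
  fixes u :: real
  assumes u: "u > 0" and fin: "liminf (\<lambda>j. ennreal (u * a j)) < \<infinity>"
  shows "liminf (\<lambda>j. ennreal (a j)) < \<infinity>"
proof (rule ccontr)
  assume "\<not> ?thesis"
  then have top: "liminf (\<lambda>j. ennreal (a j)) = \<infinity>" by (simp add: not_less top_unique)
  have "ennreal K \<le> liminf (\<lambda>j. ennreal (u * a j))" for K
  proof (rule Liminf_bounded)
    have "\<forall>\<^sub>F j in sequentially. ennreal (K / u) < ennreal (a j)"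
      using top by (intro less_LiminfD) simp
    then show "\<forall>\<^sub>F j in sequentially. ennreal K \<le> ennreal (u * a j)"
    proof eventually_elim
      case (elim j)
      then have "K / u < a j" by (meson ennreal_leI leD not_le)
      then show ?case using u by (intro ennreal_leI) (simp add: field_simps)
    qed
  qed
  then have "liminf (\<lambda>j. ennreal (u * a j)) = \<infinity>" by (rule ennreal_eq_inftyI)
  with fin show False by simp
qed

text \<open>\<open>ennreal\<close> truncates at 0, so b may be negative. This matters for the
  pairing of a nonnegative function with its resolvent, whose sign is not established.\<close>

lemma ennreal_add_le:
  assumes "0 \<le> a" shows "ennreal (a + b) \<le> ennreal a + ennreal b"
proof (cases "0 \<le> b")
  case False
  then have "ennreal (a + b) \<le> ennreal a" by (intro ennreal_leI) simp
  then show ?thesis by (simp add: add_increasing2)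
qed (use assms in simp)

lemma ennreal_integral_le_nn_integral:
  fixes f :: "'a \<Rightarrow> real"
  assumes "integrable M f" shows "ennreal (integral\<^sup>L M f) \<le> (\<integral>\<^sup>+x. ennreal (f x) \<partial>M)"
proof -
  have i: "integrable M (\<lambda>x. max 0 (f x))" using assms by simp
  have "ennreal (integral\<^sup>L M f) \<le> ennreal (\<integral>x. max 0 (f x) \<partial>M)"
    using assms i by (intro ennreal_leI integral_mono) auto
  also have "\<dots> = (\<integral>\<^sup>+x. ennreal (max 0 (f x)) \<partial>M)"
    by (rule nn_integral_eq_integral[OF i, symmetric]) simp
  also have "\<dots> = (\<integral>\<^sup>+x. ennreal (f x) \<partial>M)"
    by (rule nn_integral_cong) (simp add: max_def ennreal_neg)
  finally show ?thesis .
qed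

context order_preserving_form
begin

text \<open>Comparing the resolvent with the competitor \<open>\<phi>\<close> itself already gives a Hardy-type inequality.\<close>
lemma resolvent_pairing:
  assumes u: "u \<in> L2 M" and \<phi>: "\<phi> \<in> L2 M" and \<alpha>: "\<alpha> > 0" and e: "E \<phi> \<le> ennreal e" "e \<ge> 0"
  shows "(\<integral>x. u x * \<phi> x \<partial>M) \<le> e + \<alpha> / 2 * (\<integral>x. (\<phi> x)\<^sup>2 \<partial>M) + (\<integral>x. u x * resolvent M E \<alpha> u x \<partial>M)"
proof -
  define w where "w = resolvent M E \<alpha> u"
  let ?v = "\<lambda>x. u x / \<alpha>"
  have w: "w \<in> L2 M" unfolding w_def by (rule resolvent_L2[OF u \<alpha>])
  \<comment> \<open>The term with 1/(2\<alpha>) would blow up as \<alpha> tends to 0, but it does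
    not depend on k and cancels when w is compared with \<phi>.\<close>
  have expand: "\<alpha> / 2 * l2sq M k ?v = \<alpha> / 2 * (\<integral>x. (k x)\<^sup>2 \<partial>M) - (\<integral>x. u x * k x \<partial>M) + (\<integral>x. (u x)\<^sup>2 \<partial>M) / (2 * \<alpha>)"
    if k: "k \<in> L2 M" for k
  proof -
    have "\<alpha> / 2 * l2sq M k ?v = (\<integral>x. \<alpha> / 2 * (k x - u x / \<alpha>)\<^sup>2 \<partial>M)"
      unfolding l2sq_def by simp
    also have "\<dots> = (\<integral>x. \<alpha> / 2 * (k x)\<^sup>2 - u x * k x + (u x)\<^sup>2 / (2 * \<alpha>) \<partial>M)"
      using \<alpha> by (intro Bochner_Integration.integral_cong refl) (simp add: power2_eq_square field_simps)
    also have "\<dots> = \<alpha> / 2 * (\<integral>x. (k x)\<^sup>2 \<partial>M) - (\<integral>x. u x * k x \<partial>M) + (\<integral>x. (u x)\<^sup>2 \<partial>M) / (2 * \<alpha>)"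
      using L2_integrable_square[OF k] L2_integrable_square[OF u] L2_integrable_mult[OF u k] by simp
    finally show ?thesis .
  qed
  have "ennreal (\<alpha> / 2 * l2sq M w ?v) \<le> objective \<alpha> u w" by (simp add: objective_def)
  also have "\<dots> \<le> objective \<alpha> u \<phi>" unfolding w_def by (rule resolvent_minimal[OF u \<alpha> \<phi>])
  also have "\<dots> \<le> ennreal e + ennreal (\<alpha> / 2 * l2sq M \<phi> ?v)"
    unfolding objective_def by (intro add_right_mono e)
  also have "\<dots> = ennreal (e + \<alpha> / 2 * l2sq M \<phi> ?v)"
    using e \<alpha> by (intro ennreal_plus[symmetric]) auto
  finally have "\<alpha> / 2 * l2sq M w ?v \<le> e + \<alpha> / 2 * l2sq M \<phi> ?v"
    using e \<alpha> by (subst (asm) ennreal_le_iff) auto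
  moreover have "0 \<le> \<alpha> / 2 * (\<integral>x. (w x)\<^sup>2 \<partial>M)" using \<alpha> by simp
  ultimately show ?thesis
    unfolding expand[OF w] expand[OF \<phi>] w_def[symmetric] by linarith
qed

text \<open>Transfers the pairing estimate to data f that need not lie in L2. The resolvent is
  controlled by V only where the weight u is positive, Fatou removes the truncation of u, and the
  \<alpha>-term stays explicit because it has to vanish in the limit.\<close>

lemma resolvent_ext_weighted_bound:
  assumes u: "u \<in> L2 M" "\<And>x. 0 \<le> u x" "\<And>x. u x \<le> f x"
    and f: "f \<in> borel_measurable M" "\<And>x. 0 \<le> f x" and \<alpha>: "\<alpha> > 0"
    and V: "V \<in> borel_measurable M" "AE x in M. 0 < u x \<longrightarrow> resolvent_ext M E \<alpha> f x \<le> V x"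
    and \<phi>: "\<phi> \<in> L2 M" "\<And>x. 0 \<le> \<phi> x" and e: "E \<phi> \<le> ennreal e" "e \<ge> 0"
  shows "(\<integral>\<^sup>+x. ennreal (u x * \<phi> x) \<partial>M)
    \<le> ennreal (e + \<alpha> / 2 * (\<integral>x. (\<phi> x)\<^sup>2 \<partial>M)) + (\<integral>\<^sup>+x. ennreal (u x) * V x \<partial>M)"
proof -
  obtain us where us: "\<And>n. us n \<in> L2 M" "\<And>n x. 0 \<le> us n x" "\<And>x. incseq (\<lambda>n. us n x)"
      "\<And>x. (\<lambda>n. us n x) \<longlonglongrightarrow> f x"
    and lim: "AE x in M. (\<lambda>n. ennreal (resolvent M E \<alpha> (us n) x)) \<longlonglongrightarrow> resolvent_ext M E \<alpha> f x"
    using resolvent_ext_witness[OF f \<alpha>] by blast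
  \<comment> \<open>u need not lie below any \<open>us k\<close>; the truncation lies below both, so
    its resolvent is dominated by that of \<open>us k\<close> and hence by
    \<open>resolvent_ext\<close>.\<close>
  define uk where "uk k x = min (u x) (us k x)" for k x
  have ukL: "uk k \<in> L2 M" for k unfolding uk_def by (intro L2_min u us)
  have uk0: "0 \<le> uk k x" for k x using u(2) us(2) by (simp add: uk_def)
  note [measurable] = L2_measurable[OF ukL] L2_measurable[OF \<phi>(1)] L2_measurable[OF u(1)] V(1)
  have le: "AE x in M. 0 < u x \<longrightarrow> ennreal (resolvent M E \<alpha> (uk k) x) \<le> V x" for k
  proof -
    have "AE x in M. resolvent M E \<alpha> (uk k) x \<le> resolvent M E \<alpha> (us k) x"
      by (intro resolvent_mono ukL us \<alpha>) (simp add: uk_def)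
    with V(2) lim resolvent_incseq_AE[OF us(1,3) \<alpha>] show ?thesis
    proof eventually_elim
      case (elim x)
      have "incseq (\<lambda>n. ennreal (resolvent M E \<alpha> (us n) x))"
        using elim(3) by (auto simp: incseq_def intro: ennreal_leI)
      from incseq_le[OF this elim(2), of k] have "ennreal (resolvent M E \<alpha> (us k) x) \<le> resolvent_ext M E \<alpha> f x" .
      with elim(1,4) show ?case by (meson ennreal_leI order_trans)
    qed
  qed
  let ?C = "ennreal (e + \<alpha> / 2 * (\<integral>x. (\<phi> x)\<^sup>2 \<partial>M)) + (\<integral>\<^sup>+x. ennreal (u x) * V x \<partial>M)"
  have bd: "(\<integral>\<^sup>+x. ennreal (uk k x * \<phi> x) \<partial>M) \<le> ?C" for k
  proof -
    let ?w = "resolvent M E \<alpha> (uk k)"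
    have w: "?w \<in> L2 M" by (rule resolvent_L2[OF ukL \<alpha>])
    note [measurable] = L2_measurable[OF w]
    have "(\<integral>\<^sup>+x. ennreal (uk k x * \<phi> x) \<partial>M) = ennreal (\<integral>x. uk k x * \<phi> x \<partial>M)"
      using uk0 \<phi>(2) by (intro nn_integral_eq_integral L2_integrable_mult ukL \<phi>) auto
    also have "\<dots> \<le> ennreal ((e + \<alpha> / 2 * (\<integral>x. (\<phi> x)\<^sup>2 \<partial>M)) + (\<integral>x. uk k x * ?w x \<partial>M))"
      by (intro ennreal_leI resolvent_pairing ukL \<phi> \<alpha> e)
    also have "\<dots> \<le> ennreal (e + \<alpha> / 2 * (\<integral>x. (\<phi> x)\<^sup>2 \<partial>M)) + ennreal (\<integral>x. uk k x * ?w x \<partial>M)"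
      using e \<alpha> by (intro ennreal_add_le add_nonneg_nonneg mult_nonneg_nonneg) auto
    also have "ennreal (\<integral>x. uk k x * ?w x \<partial>M) \<le> (\<integral>\<^sup>+x. ennreal (uk k x * ?w x) \<partial>M)"
      by (intro ennreal_integral_le_nn_integral L2_integrable_mult ukL w)
    also have "\<dots> \<le> (\<integral>\<^sup>+x. ennreal (u x) * V x \<partial>M)"
    proof (rule nn_integral_mono_AE)
      show "AE x in M. ennreal (uk k x * ?w x) \<le> ennreal (u x) * V x"
        using le[of k]
      proof eventually_elim
        case (elim x)
        show ?case
        proof (cases "u x = 0")
          case True
          then show ?thesis using us(2)[of k x] by (simp add: uk_def)
        next
          case False
          then have "ennreal (?w x) \<le> V x" using elim u(2)[of x] by simp
          then show ?thesis
            unfolding ennreal_mult'[OF uk0] by (intro mult_mono ennreal_leI) (auto simp: uk_def)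
        qed
      qed
    qed
    finally show ?thesis by (simp add: add_left_mono)
  qed
  have "(\<integral>\<^sup>+x. ennreal (u x * \<phi> x) \<partial>M) = (\<integral>\<^sup>+x. liminf (\<lambda>k. ennreal (uk k x * \<phi> x)) \<partial>M)"
  proof (rule nn_integral_cong)
    fix x
    have "(\<lambda>k. min (u x) (us k x)) \<longlonglongrightarrow> min (u x) (f x)" by (intro tendsto_min tendsto_const us)
    then have "(\<lambda>k. uk k x) \<longlonglongrightarrow> u x" using u(3)[of x] by (simp add: uk_def min_def)
    then have "(\<lambda>k. ennreal (uk k x * \<phi> x)) \<longlonglongrightarrow> ennreal (u x * \<phi> x)"
      by (intro tendsto_intros)
    then show "ennreal (u x * \<phi> x) = liminf (\<lambda>k. ennreal (uk k x * \<phi> x))"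
      by (rule lim_imp_Liminf[OF sequentially_bot, symmetric])
  qed
  also have "\<dots> \<le> liminf (\<lambda>k. \<integral>\<^sup>+x. ennreal (uk k x * \<phi> x) \<partial>M)"
    by (rule nn_integral_liminf) measurable
  also have "\<dots> \<le> ?C"
    by (rule Liminf_le) (use bd in auto)
  finally show ?thesis .
qed

text \<open>For each N there is a weight that is positive exactly where \<open>S N\<close> is finite
  and against which all \<phi> have uniformly bounded integral; Fatou then bounds the limes inferior
  on that set. These sets cover almost every point: if \<open>V n x\<close> tends to a finite L,
  then \<open>S N x\<close> \<le> L + 1 for some N.\<close>

lemma subcritical_sublevels_bounded:
  assumes "subcritical M E"
  shows sublevels_bounded
  unfolding sublevels_bounded_def
proof (intro allI impI)
  fix c :: ennreal and \<phi> :: "nat \<Rightarrow> 'a \<Rightarrow> real"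
  assume c: "c < \<infinity>" and \<phi>: "\<forall>n. \<phi> n \<in> L2 M \<and> (\<forall>x. 0 \<le> \<phi> n x) \<and> E (\<phi> n) \<le> c"
  obtain e where e: "e \<ge> 0" "c = ennreal e" using c by (cases c) auto
  have \<phi>m[measurable]: "\<phi> n \<in> borel_measurable M" for n using \<phi> by (auto intro: L2_measurable)
  obtain f where f[measurable]: "f \<in> borel_measurable M" and f0: "\<And>x. 0 < f x"
    and fin: "AE x in M. \<exists>L. L < \<infinity> \<and> (\<lambda>n. resolvent_ext M E (1 / real (Suc n)) f x) \<longlonglongrightarrow> L"
    using assms unfolding subcritical_def by blast
  text \<open>\<open>resolvent_ext\<close> need not be measurable, so it is replaced by a measurable version.\<close>
  have "\<exists>V. V \<in> borel_measurable M \<and> (AE x in M. V x = resolvent_ext M E (1 / real (Suc n)) f x)" for n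
  proof -
    have pos: "0 < 1 / real (Suc n)" by simp
    obtain us where us: "\<And>k. us k \<in> L2 M" and "\<And>k x. 0 \<le> us k x" "\<And>x. incseq (\<lambda>k. us k x)"
        "\<And>x. (\<lambda>k. us k x) \<longlonglongrightarrow> f x"
      and lim: "AE x in M. (\<lambda>k. ennreal (resolvent M E (1 / real (Suc n)) (us k) x))
        \<longlonglongrightarrow> resolvent_ext M E (1 / real (Suc n)) f x"
      by (rule resolvent_ext_witness[OF f less_imp_le[OF f0] pos]) (rule that)
    have [measurable]: "resolvent M E (1 / real (Suc n)) (us k) \<in> borel_measurable M" for k
      by (rule L2_measurable[OF resolvent_L2[OF us]]) simp
    show ?thesis
    proof (intro exI conjI)
      show "(\<lambda>x. liminf (\<lambda>k. ennreal (resolvent M E (1 / real (Suc n)) (us k) x))) \<in> borel_measurable M"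
        by measurable
      show "AE x in M. liminf (\<lambda>k. ennreal (resolvent M E (1 / real (Suc n)) (us k) x))
          = resolvent_ext M E (1 / real (Suc n)) f x"
        using lim by eventually_elim (rule lim_imp_Liminf[OF sequentially_bot])
    qed
  qed
  then have "\<exists>V. \<forall>n. V n \<in> borel_measurable M \<and> (AE x in M. V n x = resolvent_ext M E (1 / real (Suc n)) f x)"
    by (intro choice allI)
  then obtain V where V[measurable]: "\<And>n. V n \<in> borel_measurable M"
    and Veq: "\<And>n. AE x in M. V n x = resolvent_ext M E (1 / real (Suc n)) f x" by blast
  \<comment> \<open>A supremum over n \<ge> N bounds all these resolvents at once, so a single
    weight can be kept fixed while \<alpha> = 1/(n+1) tends to 0.\<close>
  define S where "S N x = (SUP n\<in>{N..}. V n x)" for N x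
  have [measurable]: "S N \<in> borel_measurable M" for N unfolding S_def by measurable
  obtain p :: "'a \<Rightarrow> real" where p: "p \<in> borel_measurable M" "\<And>x. p x > 0" "integrable M p"
    and pL: "p \<in> L2 M"
    using positive_integrable_L2_function by blast
  note [measurable] = p(1)
  have main: "AE x in M. S N x < \<infinity> \<longrightarrow> liminf (\<lambda>j. ennreal (\<phi> j x)) < \<infinity>" for N
  proof -
    \<comment> \<open>The minimum keeps u below f and in L2; the denominator gives u S \<le> p, so
      the pairing with the resolvents has a bound independent of n.\<close>
    define u where "u x = (if S N x < \<infinity> then min (f x) (p x) / (1 + enn2real (S N x)) else 0)" for x
    have [measurable]: "u \<in> borel_measurable M" unfolding u_def by measurable
    have u0: "0 \<le> u x" for x using f0[of x] p(2)[of x] by (simp add: u_def)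
    have ule: "u x \<le> min (f x) (p x)" for x
    proof -
      have "min (f x) (p x) / (1 + enn2real (S N x)) \<le> min (f x) (p x) / 1"
        using f0[of x] p(2)[of x] by (intro divide_left_mono) (auto simp: add_pos_nonneg)
      then show ?thesis using f0[of x] p(2)[of x] by (simp add: u_def)
    qed
    have uL: "u \<in> L2 M"
      by (rule L2_dominated[OF pL]) (use u0 ule in \<open>auto simp: abs_of_nonneg abs_of_pos[OF p(2)]\<close>)
    have uS: "ennreal (u x) * S N x \<le> ennreal (p x)" for x
    proof (cases "S N x")
      case (real s)
      then have "ennreal (u x) * S N x = ennreal (u x * s)" using u0 by (simp add: ennreal_mult)
      also have "u x * s \<le> p x"
      proof -
        have "u x * s = min (f x) (p x) * (s / (1 + s))" using real by (simp add: u_def)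
        also have "\<dots> \<le> min (f x) (p x) * 1"
          using real f0[of x] p(2)[of x] by (intro mult_left_mono) auto
        finally show ?thesis by simp
      qed
      finally show ?thesis by (simp add: ennreal_leI)
    next
      case top
      then show ?thesis by (simp add: u_def)
    qed
    define C where "C = (\<integral>\<^sup>+x. ennreal (p x) \<partial>M)"
    have C: "C < \<infinity>"
      unfolding C_def using p by (subst nn_integral_eq_integral) (auto simp: less_imp_le)
    have bd: "(\<integral>\<^sup>+x. ennreal (u x * \<phi> j x) \<partial>M) \<le> ennreal e + C" for j
    proof -
      have "(\<integral>\<^sup>+x. ennreal (u x * \<phi> j x) \<partial>M)
          \<le> ennreal (e + 1 / real (Suc n) / 2 * (\<integral>x. (\<phi> j x)\<^sup>2 \<partial>M)) + C" if n: "n \<ge> N" for n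
      proof -
        have "(\<integral>\<^sup>+x. ennreal (u x * \<phi> j x) \<partial>M)
            \<le> ennreal (e + 1 / real (Suc n) / 2 * (\<integral>x. (\<phi> j x)\<^sup>2 \<partial>M)) + (\<integral>\<^sup>+x. ennreal (u x) * V n x \<partial>M)"
        proof (rule resolvent_ext_weighted_bound[OF uL u0 _ f less_imp_le[OF f0] _ V])
          show "AE x in M. 0 < u x \<longrightarrow> resolvent_ext M E (1 / real (Suc n)) f x \<le> V n x"
            using Veq[of n] by eventually_elim simp
        qed (use \<phi> e ule in auto)
        also have "(\<integral>\<^sup>+x. ennreal (u x) * V n x \<partial>M) \<le> C"
          unfolding C_def
        proof (rule nn_integral_mono)
          fix x
          have "V n x \<le> S N x" unfolding S_def using n by (intro SUP_upper) auto
          then have "ennreal (u x) * V n x \<le> ennreal (u x) * S N x" by (rule mult_left_mono) simp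
          with uS[of x] show "ennreal (u x) * V n x \<le> ennreal (p x)" by simp
        qed
        finally show ?thesis by (simp add: add_left_mono)
      qed
      moreover have "(\<lambda>n. ennreal (e + 1 / real (Suc n) / 2 * (\<integral>x. (\<phi> j x)\<^sup>2 \<partial>M)) + C)
          \<longlonglongrightarrow> ennreal (e + 0 / 2 * (\<integral>x. (\<phi> j x)\<^sup>2 \<partial>M)) + C"
        by (intro tendsto_intros LIMSEQ_Suc[OF lim_1_over_n]) auto
      ultimately show ?thesis by (intro LIMSEQ_le_const[of _ "ennreal e + C"]) auto
    qed
    have "(\<integral>\<^sup>+x. liminf (\<lambda>j. ennreal (u x * \<phi> j x)) \<partial>M) \<le> liminf (\<lambda>j. \<integral>\<^sup>+x. ennreal (u x * \<phi> j x) \<partial>M)"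
      by (rule nn_integral_liminf) measurable
    also have "\<dots> \<le> ennreal e + C"
      by (rule Liminf_le) (use bd in auto)
    also have "\<dots> < \<infinity>" using C by simp
    finally have "AE x in M. liminf (\<lambda>j. ennreal (u x * \<phi> j x)) \<noteq> \<infinity>"
      by (intro nn_integral_PInf_AE) auto
    then show ?thesis
    proof eventually_elim
      case (elim x)
      show ?case
      proof
        assume "S N x < \<infinity>"
        then have "u x > 0" using f0[of x] p(2)[of x] by (auto simp: u_def intro!: divide_pos_pos add_pos_nonneg)
        moreover have "liminf (\<lambda>j. ennreal (u x * \<phi> j x)) < \<infinity>"
          using elim by (simp only: infinity_ennreal_def less_top[symmetric] not_False_eq_True)
        ultimately show "liminf (\<lambda>j. ennreal (\<phi> j x)) < \<infinity>"
          by (rule liminf_ennreal_finite_scale)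
      qed
    qed
  qed
  have "AE x in M. \<forall>n. V n x = resolvent_ext M E (1 / real (Suc n)) f x"
    unfolding AE_all_countable using Veq by blast
  moreover have "AE x in M. \<forall>N. S N x < \<infinity> \<longrightarrow> liminf (\<lambda>j. ennreal (\<phi> j x)) < \<infinity>"
    unfolding AE_all_countable using main by blast
  ultimately show "AE x in M. liminf (\<lambda>j. ennreal (\<phi> j x)) < \<infinity>"
    using fin
  proof eventually_elim
    case (elim x)
    then obtain L where L: "L < \<infinity>" "(\<lambda>n. V n x) \<longlonglongrightarrow> L" by auto
    have "L < L + 1" using L(1) by (simp add: ennreal_add_left_cancel_less)
    from order_tendstoD(2)[OF L(2) this] obtain N where "\<And>n. n \<ge> N \<Longrightarrow> V n x < L + 1"
      by (auto simp: eventually_sequentially)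
    then have "S N x \<le> L + 1" unfolding S_def by (intro SUP_least) (auto intro: less_imp_le)
    also have "\<dots> < \<infinity>" using L(1) by simp
    finally show ?case using elim(2) by blast
  qed
qed

end

section \<open>Complete Luxemburg norms\<close>

context order_preserving_form
begin

text \<open>Admissibility of l in the infimum defining the Luxemburg norm. Unlike
  \<open>lux_norm\<close>, which is a real infimum even over an empty set, it is meaningful for
  every f in L2, and the norm axioms can be used without touching the infimum.\<close>

definition in_ball :: "real \<Rightarrow> ('a \<Rightarrow> real) \<Rightarrow> bool" where
  "in_ball l f \<longleftrightarrow> 0 < l \<and> E (\<lambda>x. f x / l) \<le> 1"

lemma in_ball_mono:
  assumes f: "f \<in> L2 M" and l: "in_ball l f" "l \<le> l'"
  shows "in_ball l' f"
proof -
  have pos: "0 < l" "0 < l'" using l by (auto simp: in_ball_def)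
  have "E (\<lambda>x. f x / l') = E (\<lambda>x. (l / l') * (f x / l))" using pos by simp
  also have "\<dots> \<le> ennreal (l / l') * E (\<lambda>x. f x / l)"
    using pos l by (intro E_scale L2_divide f) auto
  also have "\<dots> \<le> 1 * 1"
    using pos l by (intro mult_mono) (auto simp: in_ball_def ennreal_le_1)
  finally show ?thesis using pos by (simp add: in_ball_def)
qed

lemma in_ball_add:
  assumes f: "f \<in> L2 M" and g: "g \<in> L2 M" and "in_ball l f" "in_ball l' g"
  shows "in_ball (l + l') (\<lambda>x. f x + g x)"
proof -
  have pos: "0 < l" "0 < l'" using assms by (auto simp: in_ball_def)
  define t where "t = l / (l + l')"
  have t: "0 < t" "t < 1" "1 - t = l' / (l + l')" using pos by (auto simp: t_def field_simps)
  have "E (\<lambda>x. (f x + g x) / (l + l')) = E (\<lambda>x. t * (f x / l) + (1 - t) * (g x / l'))"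
    unfolding t(3) using pos by (simp add: t_def add_divide_distrib)
  also have "\<dots> \<le> ennreal t * E (\<lambda>x. f x / l) + ennreal (1 - t) * E (\<lambda>x. g x / l')"
    using t by (intro E_convex L2_divide f g)
  also have "\<dots> \<le> ennreal t * 1 + ennreal (1 - t) * 1"
    using assms by (intro add_mono mult_left_mono) (auto simp: in_ball_def)
  also have "\<dots> = ennreal (t + (1 - t))" using t by (subst ennreal_plus) auto
  also have "\<dots> = 1" by simp
  finally show ?thesis using pos by (simp add: in_ball_def)
qed

lemma in_ball_uminus: "f \<in> L2 M \<Longrightarrow> in_ball l f \<Longrightarrow> in_ball l (\<lambda>x. - f x)"
  using E_uminus[OF L2_divide[of f M l]] by (simp add: in_ball_def)

lemma in_ball_scale: "in_ball l f \<Longrightarrow> c > 0 \<Longrightarrow> in_ball (c * l) (\<lambda>x. c * f x)"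
  by (simp add: in_ball_def)

lemma in_ball_zero: "l > 0 \<Longrightarrow> in_ball l (\<lambda>x. 0)"
  by (simp add: in_ball_def)

lemma in_ball_closed:
  assumes fn: "\<And>n. fn n \<in> L2 M" and f: "f \<in> L2 M" and lim: "(\<lambda>n. l2sq M (fn n) f) \<longlonglongrightarrow> 0"
    and ball: "\<forall>\<^sub>F n in sequentially. in_ball l (fn n)" and l: "0 < l"
  shows "in_ball l f"
proof -
  have eq: "l2sq M (\<lambda>x. fn n x / l) (\<lambda>x. f x / l) = l2sq M (fn n) f / l\<^sup>2" for n
    unfolding l2sq_def by (simp add: diff_divide_distrib[symmetric] power_divide)
  have "(\<lambda>n. l2sq M (fn n) f / l\<^sup>2) \<longlonglongrightarrow> 0 / l\<^sup>2"
    by (intro tendsto_divide lim tendsto_const) (use l in auto)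
  then have "E (\<lambda>x. f x / l) \<le> liminf (\<lambda>n. E (\<lambda>x. fn n x / l))"
    by (intro E_lsc L2_divide fn f) (simp add: eq)
  also have "\<dots> \<le> 1"
    by (rule Liminf_le) (use ball in \<open>auto simp: in_ball_def elim: eventually_mono\<close>)
  finally show ?thesis using l by (simp add: in_ball_def)
qed

lemma midhull_in_ball:
  assumes "z \<in> L2 M"
  shows "g \<in> midhull S \<Longrightarrow> S \<subseteq> L2 M \<Longrightarrow> (\<And>f. f \<in> S \<Longrightarrow> in_ball l (\<lambda>x. f x - z x)) \<Longrightarrow>
    in_ball l (\<lambda>x. g x - z x)"
proof (induction rule: midhull.induct)
  case (mid f g)
  have "f \<in> L2 M" "g \<in> L2 M" using mid by (auto intro: midhull_L2)
  then have L: "(\<lambda>x. f x - z x) \<in> L2 M" "(\<lambda>x. g x - z x) \<in> L2 M" using assms by (auto intro: L2_diff)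
  have "in_ball l (\<lambda>x. f x - z x)" "in_ball l (\<lambda>x. g x - z x)" using mid by auto
  from in_ball_scale[OF in_ball_add[OF L this], of "1/2"]
  have "in_ball l (\<lambda>x. 1/2 * ((f x - z x) + (g x - z x)))" by simp
  moreover have "(\<lambda>x. 1/2 * ((f x - z x) + (g x - z x))) = (\<lambda>x. (f x + g x) / 2 - z x)"
    by (simp add: fun_eq_iff field_simps)
  ultimately show ?case by simp
qed auto

text \<open>By convexity and E(0) = 0 the energy along a ray is bounded linearly near 0, so energy
  at most 1 at a single scale already forces it to tend to 0.\<close>

lemma ME_iff: "f \<in> ME M E \<longleftrightarrow> f \<in> L2 M \<and> (\<exists>l. in_ball l f)"
proof
  assume "f \<in> ME M E"
  then have f: "f \<in> L2 M" and lim: "((\<lambda>l::real. E (\<lambda>x. l * f x)) \<longlongrightarrow> 0) (at_right 0)"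
    by (auto simp: ME_def)
  from order_tendstoD(2)[OF lim, of 1] obtain b :: real where b: "b > 0" "\<And>y. 0 < y \<Longrightarrow> y < b \<Longrightarrow> E (\<lambda>x. y * f x) < 1"
    by (auto simp: eventually_at_right_field)
  have "in_ball (2 / b) f" using b(2)[of "b / 2"] b(1) by (simp add: in_ball_def mult.commute)
  with f show "f \<in> L2 M \<and> (\<exists>l. in_ball l f)" by blast
next
  assume "f \<in> L2 M \<and> (\<exists>l. in_ball l f)"
  then obtain l where f: "f \<in> L2 M" and l: "l > 0" "E (\<lambda>x. f x / l) \<le> 1" by (auto simp: in_ball_def)
  have "((\<lambda>t::real. E (\<lambda>x. t * f x)) \<longlongrightarrow> 0) (at_right 0)"
  proof (rule tendsto_sandwich[OF _ _ tendsto_const])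
    show "\<forall>\<^sub>F t in at_right 0. E (\<lambda>x. t * f x) \<le> ennreal (t * l)"
    proof (rule eventually_at_rightI)
      fix t assume t: "t \<in> {0<..<1 / l}"
      have "E (\<lambda>x. t * f x) = E (\<lambda>x. (t * l) * (f x / l))" using l by simp
      also have "\<dots> \<le> ennreal (t * l) * E (\<lambda>x. f x / l)"
        using t l by (intro E_scale L2_divide f) (auto simp: field_simps)
      also have "\<dots> \<le> ennreal (t * l) * 1" by (intro mult_left_mono l) auto
      finally show "E (\<lambda>x. t * f x) \<le> ennreal (t * l)" by simp
    qed (use l in simp)
    have "((\<lambda>t. ennreal (t * l)) \<longlongrightarrow> ennreal (0 * l)) (at_right 0)"
      by (intro tendsto_ennrealI tendsto_mult tendsto_const tendsto_ident_at)
    then show "((\<lambda>t. ennreal (t * l)) \<longlongrightarrow> 0) (at_right 0)" by simp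
  qed auto
  with f show "f \<in> ME M E" by (simp add: ME_def)
qed

lemma lux_norm_le: "in_ball l f \<Longrightarrow> lux_norm E f \<le> l"
  unfolding lux_norm_def by (intro cInf_lower bdd_belowI[of _ 0]) (auto simp: in_ball_def)

lemma lux_norm_less_in_ball:
  assumes "f \<in> ME M E" "lux_norm E f < l" shows "in_ball l f"
proof -
  have "{l. l > 0 \<and> E (\<lambda>x. f x / l) \<le> 1} \<noteq> {}" using assms(1) by (auto simp: ME_iff in_ball_def)
  from cInf_lessD[OF this assms(2)[unfolded lux_norm_def]]
  obtain k where "in_ball k f" "k < l" by (auto simp: in_ball_def)
  then show ?thesis using assms(1) by (auto simp: ME_iff intro: in_ball_mono)
qed

lemma lux_norm_eq_0:
  assumes "\<And>l. l > 0 \<Longrightarrow> in_ball l f" shows "lux_norm E f = 0"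
proof (rule antisym)
  show "lux_norm E f \<le> 0"
    by (rule field_le_epsilon) (use lux_norm_le[OF assms] in simp)
  have "1 \<in> {l. l > 0 \<and> E (\<lambda>x. f x / l) \<le> 1}"
    using assms[of 1] by (simp add: in_ball_def)
  then have "{l. l > 0 \<and> E (\<lambda>x. f x / l) \<le> 1} \<noteq> {}" by blast
  then show "0 \<le> lux_norm E f"
    unfolding lux_norm_def by (rule cInf_greatest) simp
qed

text \<open>If it failed, some y k would tend to z in the Luxemburg sense with squared L2 norms at
  most b. Hull elements converge in L2 to some w with the same bound; closedness of Luxemburg balls
  in L2 puts w - z into every ball, and definiteness of the norm gives w = z almost
  everywhere.\<close>

lemma L2_norm_lower_semicontinuous:
  assumes sep: "\<And>f. f \<in> ME M E \<Longrightarrow> lux_norm E f = 0 \<Longrightarrow> AE x in M. f x = 0"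
    and z: "z \<in> L2 M" and b: "b < l2sq M z (\<lambda>x. 0)"
  shows "\<exists>r>0. \<forall>y\<in>L2 M. in_ball r (\<lambda>x. y x - z x) \<longrightarrow> b < l2sq M y (\<lambda>x. 0)"
proof (rule ccontr)
  assume "\<not> ?thesis"
  then have "\<forall>r>0. \<exists>y\<in>L2 M. in_ball r (\<lambda>x. y x - z x) \<and> l2sq M y (\<lambda>x. 0) \<le> b"
    by (meson not_less)
  moreover have "0 < 1 / real (Suc k)" for k by simp
  ultimately have "\<forall>k. \<exists>y. y \<in> L2 M \<and> in_ball (1 / real (Suc k)) (\<lambda>x. y x - z x) \<and> l2sq M y (\<lambda>x. 0) \<le> b"
    by blast
  from choice[OF this] obtain y where y: "\<And>k. y k \<in> L2 M" "\<And>k. in_ball (1 / real (Suc k)) (\<lambda>x. y k x - z x)"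
      "\<And>k. l2sq M (y k) (\<lambda>x. 0) \<le> b"
    by blast
  obtain g w where g: "\<And>n. g n \<in> midhull (y ` {n..})" and w: "w \<in> L2 M"
    and lim: "(\<lambda>n. l2sq M (g n) w) \<longlonglongrightarrow> 0"
    using L2_bounded_midhull_convergent[of y, OF y(1) y(3)] by blast
  have gL: "g n \<in> L2 M" for n using y(1) by (intro midhull_L2[OF g]) auto
  have "l2sq M (g n) (\<lambda>x. 0) \<le> b" for n
    using y by (intro midhull_l2sq_le[OF g]) auto
  then have wb: "l2sq M w (\<lambda>x. 0) \<le> b"
    by (intro LIMSEQ_le_const2[OF l2sq_tendsto[OF gL w L2_zero lim]]) auto
  have gball: "in_ball (1 / real (Suc n)) (\<lambda>x. g n x - z x)" for n
  proof (rule midhull_in_ball[OF z g])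
    fix f assume "f \<in> y ` {n..}"
    then obtain k where k: "k \<ge> n" "f = y k" by auto
    show "in_ball (1 / real (Suc n)) (\<lambda>x. f x - z x)"
      unfolding k(2) using k(1) by (intro in_ball_mono[OF _ y(2)] L2_diff y z) (simp add: field_simps)
  qed (use y in auto)
  have wz: "(\<lambda>x. w x - z x) \<in> L2 M" using w z by (rule L2_diff)
  have "in_ball l (\<lambda>x. w x - z x)" if l: "l > 0" for l
  proof (rule in_ball_closed[OF L2_diff[OF gL z] wz _ _ l])
    show "(\<lambda>n. l2sq M (\<lambda>x. g n x - z x) (\<lambda>x. w x - z x)) \<longlonglongrightarrow> 0"
      using lim by (simp add: l2sq_def)
    have "\<forall>\<^sub>F n in sequentially. 1 / real (Suc n) < l"
      using l by (intro order_tendstoD(2)[OF LIMSEQ_Suc[OF lim_1_over_n]])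
    then show "\<forall>\<^sub>F n in sequentially. in_ball l (\<lambda>x. g n x - z x)"
      by eventually_elim (use in_ball_mono[OF L2_diff[OF gL z] gball] in simp)
  qed
  then have "AE x in M. w x - z x = 0"
    using wz by (intro sep lux_norm_eq_0) (auto simp: ME_iff intro: exI[of _ 1])
  then have "AE x in M. w x = z x" by eventually_elim simp
  then have "l2sq M w (\<lambda>x. 0) = l2sq M z (\<lambda>x. 0)"
    using w z by (intro l2sq_cong_AE) (auto intro: L2_measurable)
  with wb b show False by simp
qed

text \<open>A nested-ball argument in the style of Baire: otherwise one finds a point of the complete
  space at which the lower semicontinuous \<open>L2\<close>-norm exceeds every number.\<close>
lemma lux_banach_L2_bound:
  assumes banach: "lux_banach M E"
  obtains C where "\<And>f. f \<in> L2 M \<Longrightarrow> E f \<le> 1 \<Longrightarrow> l2sq M f (\<lambda>x. 0) \<le> C"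
proof (rule ccontr)
  assume "\<not> thesis"
  then have unbounded: "\<exists>f\<in>L2 M. E f \<le> 1 \<and> C < l2sq M f (\<lambda>x. 0)" for C
    using that by (meson not_le)
  have sep: "\<And>f. f \<in> ME M E \<Longrightarrow> lux_norm E f = 0 \<Longrightarrow> AE x in M. f x = 0"
    using banach by (auto simp: lux_banach_def)
  define P where "P s \<longleftrightarrow> fst s \<in> ME M E \<and> 0 < snd s" for s :: "('a \<Rightarrow> real) \<times> real"
  \<comment> \<open>A state is a centre and a radius. Moving the centre by a quarter of the radius
    and at least halving the radius keeps the later centres within half the radius; on the n-th new
    ball the squared L2 norm exceeds n.\<close>
  define Q where "Q n s s' \<longleftrightarrow> snd s' \<le> snd s / 2 \<and> in_ball (snd s / 4) (\<lambda>x. fst s' x - fst s x) \<and>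
      (\<forall>y\<in>L2 M. in_ball (snd s') (\<lambda>x. y x - fst s' x) \<longrightarrow> real n < l2sq M y (\<lambda>x. 0))"
    for n :: nat and s s' :: "('a \<Rightarrow> real) \<times> real"
  have "\<exists>s. \<forall>n. P (s n) \<and> Q n (s n) (s (Suc n))"
  proof (rule dependent_nat_choice)
    have "P (\<lambda>x. 0, 1)" unfolding P_def ME_iff using in_ball_zero[of 1] by auto
    then show "\<exists>s. P s" by blast
  next
    fix s n assume P: "P s"
    obtain x r where s: "s = (x, r)" by (cases s)
    have x: "x \<in> ME M E" "x \<in> L2 M" and r: "r > 0" using P by (auto simp: P_def s ME_iff)
    define c where "c = r / 4"
    have c: "c > 0" using r by (simp add: c_def)
    obtain z where z: "z \<in> L2 M" "E z \<le> 1" "real n / c\<^sup>2 < l2sq M z (\<lambda>x. 0)"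
      using unbounded by blast
    have z1: "in_ball c (\<lambda>x. c * z x)" using in_ball_scale[of 1 z c] z(2) c by (simp add: in_ball_def)
    have cz: "(\<lambda>x. c * z x) \<in> L2 M" using z(1) by (rule L2_cmult)
    \<comment> \<open>Nothing is known about the inner product of x and z, so both signs are tried:
      the squared norms of x + c z and x - c z average to at least c^2 times that of z. Hence the
      threshold n / c^2 in the choice of z.\<close>
    define p q where "p = (\<lambda>t. x t + c * z t)" and "q = (\<lambda>t. x t - c * z t)"
    have pq: "p \<in> L2 M" "q \<in> L2 M" unfolding p_def q_def by (intro L2_add L2_diff x cz)+
    have "real n < c\<^sup>2 * l2sq M z (\<lambda>x. 0)" using z(3) c by (simp add: field_simps)
    also have "\<dots> = l2sq M p q / 4"
      unfolding l2sq_def p_def q_def by (simp add: power_mult_distrib)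
    also have "\<dots> \<le> (l2sq M p (\<lambda>x. 0) + l2sq M q (\<lambda>x. 0)) / 2"
      using l2sq_parallelogram[OF pq L2_zero] l2sq_nonneg[of M "\<lambda>x. (p x + q x) / 2" "\<lambda>x. 0"] by linarith
    finally have "real n < l2sq M p (\<lambda>x. 0) \<or> real n < l2sq M q (\<lambda>x. 0)" by argo
    moreover have "in_ball c (\<lambda>t. p t - x t)" using z1 by (simp add: p_def)
    moreover have "in_ball c (\<lambda>t. q t - x t)" using in_ball_uminus[OF cz z1] by (simp add: q_def)
    ultimately obtain x' where x': "x' \<in> L2 M" "in_ball c (\<lambda>t. x' t - x t)" "real n < l2sq M x' (\<lambda>x. 0)"
      using pq by blast
    have "x' \<in> ME M E"
    proof -
      obtain l where "in_ball l x" using x by (auto simp: ME_iff)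
      from in_ball_add[OF L2_diff[OF x'(1) x(2)] x(2) x'(2) this] show ?thesis
        using x' by (auto simp: ME_iff)
    qed
    moreover obtain r' where r': "r' > 0" "\<forall>y\<in>L2 M. in_ball r' (\<lambda>t. y t - x' t) \<longrightarrow> real n < l2sq M y (\<lambda>x. 0)"
      using L2_norm_lower_semicontinuous[OF sep x'(1,3)] by blast
    ultimately have "P (x', min r' (r / 2)) \<and> Q n s (x', min r' (r / 2))"
    proof -
      have "real n < l2sq M y (\<lambda>x. 0)" if y: "y \<in> L2 M" "in_ball (min r' (r / 2)) (\<lambda>t. y t - x' t)" for y
        using r'(2) y(1) in_ball_mono[OF L2_diff[OF y(1) x'(1)] y(2), of r'] by simp
      then show ?thesis using \<open>x' \<in> ME M E\<close> r'(1) r x'(2) by (simp add: P_def Q_def s c_def)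
    qed
    then show "\<exists>s'. P s' \<and> Q n s s'" by blast
  qed
  then obtain s where s: "\<And>n. P (s n)" "\<And>n. Q n (s n) (s (Suc n))" by blast
  define X R where "X n = fst (s n)" and "R n = snd (s n)" for n
  have XM: "X n \<in> ME M E" and XL: "X n \<in> L2 M" and R0: "R n > 0" for n
    using s(1)[of n] by (auto simp: P_def X_def R_def ME_iff)
  have R2: "R (Suc n) \<le> R n / 2" and step: "in_ball (R n / 4) (\<lambda>x. X (Suc n) x - X n x)"
    and big: "y \<in> L2 M \<Longrightarrow> in_ball (R (Suc n)) (\<lambda>x. y x - X (Suc n) x) \<Longrightarrow> real n < l2sq M y (\<lambda>x. 0)" for n y
    using s(2)[of n] by (auto simp: Q_def X_def R_def)
  \<comment> \<open>Halving of the radii gives R k / 4 \<le> (R k - R (k+1)) / 2, so the step sizes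
    telescope. Keeping the subtracted term makes the induction close.\<close>
  have chain: "in_ball (R n / 2 - R (n + Suc k) / 2) (\<lambda>x. X (n + Suc k) x - X n x)" for n k
  proof (induction k)
    case 0
    show ?case
      using R2[of n] in_ball_mono[OF L2_diff[OF XL XL] step[of n]] by simp
  next
    case (Suc k)
    have "in_ball (R (n + Suc k) / 4) (\<lambda>x. X (n + Suc (Suc k)) x - X (n + Suc k) x)"
      using step[of "n + Suc k"] by simp
    from in_ball_add[OF L2_diff[OF XL XL] L2_diff[OF XL XL] Suc this]
    have "in_ball (R n / 2 - R (n + Suc k) / 2 + R (n + Suc k) / 4) (\<lambda>x. X (n + Suc (Suc k)) x - X n x)"
      by simp
    then show ?case
      by (rule in_ball_mono[OF L2_diff[OF XL XL]]) (use R2[of "n + Suc k"] in simp)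
  qed
  have tail: "in_ball (R n / 2) (\<lambda>x. X m x - X n x)" if "m \<ge> n" for m n
  proof (cases "m = n")
    case True
    then show ?thesis using R0[of n] by (simp add: in_ball_zero)
  next
    case False
    then obtain k where k: "m = n + Suc k" using \<open>m \<ge> n\<close> less_imp_Suc_add[of n m] by auto
    show ?thesis
      unfolding k by (rule in_ball_mono[OF L2_diff[OF XL XL] chain]) (use R0[of "n + Suc k"] in simp)
  qed
  have Rle: "R n \<le> R 0 * (1/2)^n" for n
  proof (induction n)
    case (Suc n)
    then show ?case using R2[of n] by simp
  qed simp
  have Rlim: "R \<longlonglongrightarrow> 0"
  proof (rule tendsto_sandwich)
    show "\<forall>\<^sub>F n in sequentially. 0 \<le> R n" using R0 by (simp add: less_imp_le)
    show "\<forall>\<^sub>F n in sequentially. R n \<le> R 0 * (1/2)^n" using Rle by simp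
    have "(\<lambda>n. R 0 * (1/2)^n) \<longlonglongrightarrow> R 0 * 0"
      by (intro tendsto_mult tendsto_const LIMSEQ_power_zero) simp
    then show "(\<lambda>n. R 0 * (1/2)^n) \<longlonglongrightarrow> 0" by simp
  qed simp
  have Rdec: "R n \<le> R m" if "m \<le> n" for m n
    using that
  proof (induction rule: dec_induct)
    case (step n)
    then show ?case using R2[of n] R0[of n] by linarith
  qed simp
  have "\<exists>N. \<forall>m\<ge>N. \<forall>n\<ge>N. lux_norm E (\<lambda>x. X m x - X n x) < e" if e: "e > 0" for e
  proof -
    obtain N where N: "R N < e"
      using order_tendstoD(2)[OF Rlim e] by (auto simp: eventually_sequentially)
    have "lux_norm E (\<lambda>x. X m x - X n x) < e" if mn: "m \<ge> N" "n \<ge> N" for m n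
    proof -
      have "in_ball (R N) (\<lambda>x. X m x - X n x)"
      proof (cases "n \<le> m")
        case True
        then show ?thesis using Rdec[OF mn(2)] R0[of n]
          by (intro in_ball_mono[OF L2_diff[OF XL XL] tail]) auto
      next
        case False
        then have "in_ball (R m / 2) (\<lambda>x. - (X n x - X m x))"
          by (intro in_ball_uminus L2_diff XL tail) simp
        then have "in_ball (R m / 2) (\<lambda>x. X m x - X n x)" by simp
        then show ?thesis
          by (rule in_ball_mono[OF L2_diff[OF XL XL]]) (use Rdec[OF mn(1)] R0[of m] in simp)
      qed
      from lux_norm_le[OF this] N show ?thesis by simp
    qed
    then show ?thesis by blast
  qed
  then obtain x where x: "x \<in> ME M E" and lim: "(\<lambda>n. lux_norm E (\<lambda>t. X n t - x t)) \<longlonglongrightarrow> 0"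
    using banach XM unfolding lux_banach_def by blast
  have xL: "x \<in> L2 M" using x by (simp add: ME_iff)
  have "real n < l2sq M x (\<lambda>x. 0)" for n
  proof (rule big[OF xL])
    have diffM: "(\<lambda>t. X k t - x t) \<in> ME M E" for k
    proof -
      obtain l l' where "in_ball l (X k)" "in_ball l' x" using x XM[of k] by (auto simp: ME_iff)
      from in_ball_add[OF XL L2_uminus[OF xL] this(1) in_ball_uminus[OF xL this(2)]] show ?thesis
        using L2_diff[OF XL xL] by (auto simp: ME_iff)
    qed
    \<comment> \<open>\<open>tail\<close> uses only half of the radius. The other half is spent on
      the distance from \<open>X k\<close> to the limit, which therefore lies in the ball where the
      squared norm exceeds n.\<close>
    have "\<forall>\<^sub>F k in sequentially. lux_norm E (\<lambda>t. X k t - x t) < R (Suc n) / 2"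
      using lim R0[of "Suc n"] by (intro order_tendstoD(2)) auto
    then obtain K where K: "\<And>k. k \<ge> K \<Longrightarrow> lux_norm E (\<lambda>t. X k t - x t) < R (Suc n) / 2"
      by (auto simp: eventually_sequentially)
    define k where "k = max K (Suc n)"
    have "in_ball (R (Suc n) / 2) (\<lambda>t. X k t - x t)"
      by (rule lux_norm_less_in_ball[OF diffM K]) (simp add: k_def)
    then have 1: "in_ball (R (Suc n) / 2) (\<lambda>t. - (X k t - x t))"
      by (rule in_ball_uminus[OF L2_diff[OF XL xL]])
    have 2: "in_ball (R (Suc n) / 2) (\<lambda>t. X k t - X (Suc n) t)"
      by (rule tail) (simp add: k_def)
    from in_ball_add[OF L2_uminus[OF L2_diff[OF XL xL]] L2_diff[OF XL XL] 1 2]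
    show "in_ball (R (Suc n)) (\<lambda>t. x t - X (Suc n) t)" by simp
  qed
  moreover obtain n where "l2sq M x (\<lambda>x. 0) < real n" using reals_Archimedean2 by blast
  ultimately show False by (meson less_asym)
qed

section \<open>Consequences of the L2 bound: bounded sublevel sets and equality of the form with its
  extension\<close>

lemma lux_banach_sublevel_L2_bound:
  assumes "lux_banach M E" "c < \<infinity>"
  obtains B where "\<And>f. f \<in> L2 M \<Longrightarrow> E f \<le> c \<Longrightarrow> l2sq M f (\<lambda>x. 0) \<le> B"
proof -
  obtain C where C: "\<And>f. f \<in> L2 M \<Longrightarrow> E f \<le> 1 \<Longrightarrow> l2sq M f (\<lambda>x. 0) \<le> C"
    using lux_banach_L2_bound[OF assms(1)] by blast
  obtain r where r: "r \<ge> 0" "c = ennreal r" using assms(2) by (cases c) auto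
  \<comment> \<open>The added 1 ensures d \<ge> 1, so 1/d is an admissible convexity factor that
    brings the energy down to at most 1.\<close>
  define d where "d = r + 1"
  have d: "d \<ge> 1" "c \<le> ennreal d" using r by (auto simp: d_def ennreal_leI)
  show thesis
  proof (rule that[of "d\<^sup>2 * C"])
    fix f assume f: "f \<in> L2 M" "E f \<le> c"
    have "E (\<lambda>x. (1 / d) * f x) \<le> ennreal (1 / d) * E f"
      using d by (intro E_scale f) auto
    also have "\<dots> \<le> ennreal (1 / d) * ennreal d"
      by (intro mult_left_mono order_trans[OF f(2) d(2)]) auto
    also have "\<dots> = 1" using d by (subst ennreal_mult[symmetric]) auto
    finally have "l2sq M (\<lambda>x. (1 / d) * f x) (\<lambda>x. 0) \<le> C"
      by (intro C L2_cmult f)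
    then show "l2sq M f (\<lambda>x. 0) \<le> d\<^sup>2 * C"
      using d by (simp add: l2sq_def power_divide field_simps)
  qed
qed

lemma lux_banach_sublevels_bounded:
  assumes "lux_banach M E" shows sublevels_bounded
  unfolding sublevels_bounded_def
proof (intro allI impI)
  fix c :: ennreal and \<phi> :: "nat \<Rightarrow> 'a \<Rightarrow> real"
  assume c: "c < \<infinity>" and \<phi>: "\<forall>n. \<phi> n \<in> L2 M \<and> (\<forall>x. 0 \<le> \<phi> n x) \<and> E (\<phi> n) \<le> c"
  have [measurable]: "\<phi> n \<in> borel_measurable M" for n using \<phi> by (auto intro: L2_measurable)
  obtain B where B: "\<And>f. f \<in> L2 M \<Longrightarrow> E f \<le> c \<Longrightarrow> l2sq M f (\<lambda>x. 0) \<le> B"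
    using lux_banach_sublevel_L2_bound[OF assms c] by blast
  have bd: "(\<integral>\<^sup>+x. ennreal ((\<phi> j x)\<^sup>2) \<partial>M) \<le> ennreal B" for j
    using l2sq_nn_integral[of "\<phi> j" M "\<lambda>x. 0"] B[of "\<phi> j"] \<phi> by (simp add: ennreal_leI)
  have "(\<integral>\<^sup>+x. liminf (\<lambda>j. ennreal ((\<phi> j x)\<^sup>2)) \<partial>M) \<le> liminf (\<lambda>j. \<integral>\<^sup>+x. ennreal ((\<phi> j x)\<^sup>2) \<partial>M)"
    by (rule nn_integral_liminf) measurable
  also have "\<dots> \<le> ennreal B"
    by (rule Liminf_le) (use bd in auto)
  finally have "(\<integral>\<^sup>+x. liminf (\<lambda>j. ennreal ((\<phi> j x)\<^sup>2)) \<partial>M) \<noteq> \<infinity>" by (auto simp: top_unique)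
  then have "AE x in M. liminf (\<lambda>j. ennreal ((\<phi> j x)\<^sup>2)) \<noteq> \<infinity>"
    by (intro nn_integral_PInf_AE) auto
  then show "AE x in M. liminf (\<lambda>j. ennreal (\<phi> j x)) < \<infinity>"
  proof eventually_elim
    case (elim x)
    show ?case
    proof (rule ccontr)
      assume "\<not> ?thesis"
      then have top: "liminf (\<lambda>j. ennreal (\<phi> j x)) = \<infinity>" by (simp add: not_less top_unique)
      have "ennreal K \<le> liminf (\<lambda>j. ennreal ((\<phi> j x)\<^sup>2))" for K
      proof (rule Liminf_bounded)
        \<comment> \<open>Above 1 a number is at most its square, so a lower bound by max(1, K)
          passes to the squares.\<close>
        have "\<forall>\<^sub>F j in sequentially. ennreal (max 1 K) < ennreal (\<phi> j x)"
          using top by (intro less_LiminfD) simp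
        then show "\<forall>\<^sub>F j in sequentially. ennreal K \<le> ennreal ((\<phi> j x)\<^sup>2)"
        proof eventually_elim
          case (elim j)
          then have *: "max 1 K < \<phi> j x" by (meson ennreal_leI leD not_le)
          then have "\<phi> j x * 1 \<le> \<phi> j x * \<phi> j x" by (intro mult_left_mono) auto
          then show ?case using * unfolding power2_eq_square by (intro ennreal_leI) linarith
        qed
      qed
      then have "liminf (\<lambda>j. ennreal ((\<phi> j x)\<^sup>2)) = \<infinity>" by (rule ennreal_eq_inftyI)
      with elim show False by simp
    qed
  qed
qed

text \<open>A recovery sequence is bounded in L2, so hull elements converge there. They still
  converge almost everywhere to f, which places f itself in L2 and lets the lower semicontinuity of
  \<open>E\<close> act.\<close>

lemma lux_banach_Ee_eq_Ebar:
  assumes banach: "lux_banach M E" and f: "f \<in> L0 M"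
  shows "Ee M E f = Ebar M E f"
proof (rule antisym)
  have "loc_meas_conv M (\<lambda>n. f) f" by (simp add: loc_meas_conv_def)
  then have "Ee M E f \<le> liminf (\<lambda>n::nat. Ebar M E f)"
    unfolding Ee_def using f by (intro Inf_lower) auto
  then show "Ee M E f \<le> Ebar M E f" by (simp add: Liminf_const)
  show "Ebar M E f \<le> Ee M E f"
  proof (cases "Ee M E f < \<infinity>")
    case True
    obtain \<phi> where \<phi>: "\<And>n. \<phi> n \<in> L2 M" "\<And>n. E (\<phi> n) < Ee M E f + ennreal (1 / real (Suc n))"
        "AE x in M. (\<lambda>n. \<phi> n x - f x) \<longlonglongrightarrow> 0"
      using Ee_recovery[of "\<lambda>n. f" "\<lambda>n. Ee M E f + ennreal (1 / real (Suc n))"]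
        f less_add_inverse_Suc[OF True] by blast
    have \<phi>E: "E (\<phi> k) \<le> Ee M E f + ennreal (1 / real (Suc n))" if "k \<ge> n" for n k
    proof -
      have "E (\<phi> k) \<le> Ee M E f + ennreal (1 / real (Suc k))" using \<phi>(2)[of k] by simp
      also have "\<dots> \<le> Ee M E f + ennreal (1 / real (Suc n))"
        using that by (intro add_left_mono ennreal_leI) (simp add: field_simps)
      finally show ?thesis .
    qed
    have "Ee M E f + 1 < \<infinity>" using True by simp
    then obtain B where B: "\<And>f'. f' \<in> L2 M \<Longrightarrow> E f' \<le> Ee M E f + 1 \<Longrightarrow> l2sq M f' (\<lambda>x. 0) \<le> B"
      using lux_banach_sublevel_L2_bound[OF banach] by blast
    have "l2sq M (\<phi> k) (\<lambda>x. 0) \<le> B" for k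
      using \<phi>E[of 0 k] by (intro B \<phi>) simp
    then obtain g w where g: "\<And>n. g n \<in> midhull (\<phi> ` {n..})" and w: "w \<in> L2 M"
      and lim: "(\<lambda>n. l2sq M (g n) w) \<longlonglongrightarrow> 0" and ae: "AE x in M. (\<lambda>n. g n x) \<longlonglongrightarrow> w x"
      using L2_bounded_midhull_convergent[of \<phi>, OF \<phi>(1)] by blast
    have gL: "g n \<in> L2 M" for n using \<phi>(1) by (intro midhull_L2[OF g]) auto
    have gE: "E (g n) \<le> Ee M E f + ennreal (1 / real (Suc n))" for n
      using \<phi>(1) \<phi>E by (intro midhull_E_le[OF g]) auto
    have eq: "AE x in M. f x = w x"
      using ae \<phi>(3)
    proof eventually_elim
      case (elim x)
      have "(\<lambda>n. \<phi> n x) \<longlonglongrightarrow> f x" using elim(2) by (simp add: LIM_zero_iff)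
      from midhull_tail_tendsto[OF g this] elim(1) show ?case by (rule LIMSEQ_unique)
    qed
    have fL: "f \<in> L2 M"
      using f eq by (intro L2_dominated[OF w]) (auto simp: L0_def elim: eventually_mono)
    have "E f = E w" by (rule E_cong_AE[OF fL w eq])
    also have "\<dots> \<le> liminf (\<lambda>n. E (g n))" by (rule E_lsc[OF gL w lim])
    also have "\<dots> \<le> liminf (\<lambda>n. Ee M E f + ennreal (1 / real (Suc n)))"
      by (intro Liminf_mono always_eventually allI gE)
    also have "\<dots> = Ee M E f"
      by (rule lim_imp_Liminf[OF sequentially_bot tendsto_add_inverse_Suc])
    finally show ?thesis using fL by (simp add: Ebar_def)
  qed (simp add: not_less top_unique)
qed

lemma lux_banach_Ee_exists:
  assumes banach: "lux_banach M E" shows "Ee_exists M E"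
  unfolding Ee_exists_def
proof (intro allI impI)
  fix fs f
  assume fs: "\<forall>n. fs n \<in> L2 M \<and> E (fs n) < \<infinity>" and f: "f \<in> L2 M" and conv: "loc_meas_conv M fs f"
  have "E f = Ee M E f"
    using lux_banach_Ee_eq_Ebar[OF banach, of f] f by (simp add: Ebar_def L0_def L2_def)
  also have "\<dots> \<le> liminf (\<lambda>n. Ebar M E (fs n))"
    unfolding Ee_def using fs conv by (intro Inf_lower) (auto simp: L0_def L2_def)
  finally show "E f \<le> liminf (\<lambda>n. E (fs n))" using fs by (simp add: Ebar_def)
qed

end

section \<open>Assembly of both cases, with uniqueness under strict convexity\<close>

theorem theorem5p3:
  fixes M :: "'a measure" and E :: "('a \<Rightarrow> real) \<Rightarrow> ennreal"
  assumes "sigma_finite_measure M"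
    and "nonlinear_order_preserving_form M E"
    and "lux_banach M E \<or> (Ee_exists M E \<and> reflexive_form M E \<and> subcritical M E)"
  shows
    "(\<forall>g\<in>L0 M. \<forall>A\<in>sets M. (\<exists>f\<in>DEe M E. AE x in M. x \<in> A \<longrightarrow> g x \<le> f x) \<longrightarrow>
       (\<exists>h. excessive M E h \<and> (\<forall>x. 0 \<le> h x) \<and> h \<in> DEe M E \<and>
            (AE x in M. x \<in> A \<longrightarrow> g x \<le> h x) \<and>
            (\<forall>f\<in>L0 M. (AE x in M. x \<in> A \<longrightarrow> g x \<le> f x) \<longrightarrow> Ee M E h \<le> Ee M E f) \<and>
            (Ee_strictly_convex M E \<longrightarrow>
               (\<forall>h'. excessive M E h' \<and> (\<forall>x. 0 \<le> h' x) \<and> h' \<in> DEe M E \<and>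
                  (AE x in M. x \<in> A \<longrightarrow> g x \<le> h' x) \<and>
                  (\<forall>f\<in>L0 M. (AE x in M. x \<in> A \<longrightarrow> g x \<le> f x) \<longrightarrow> Ee M E h' \<le> Ee M E f)
                  \<longrightarrow> (AE x in M. h' x = h x))) \<and>
            (lux_banach M E \<longrightarrow>
               Ee_exists M E \<and> (\<forall>f\<in>L0 M. Ee M E f = Ebar M E f) \<and>
               h \<in> L2 M \<and> E h < \<infinity>)))
     \<and> ((\<exists>g\<in>DEe M E. AE x in M. 0 < g x) \<longrightarrow>
        (\<exists>h. excessive M E h \<and> (\<forall>x. 0 < h x)))"
proof -
  interpret order_preserving_form M E
    using assms(1,2) by (simp add: order_preserving_form_def order_preserving_form_axioms_def)
  have bounded: sublevels_bounded
    using assms(3) lux_banach_sublevels_bounded subcritical_sublevels_bounded by blast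
  show ?thesis
  proof (intro conjI ballI impI)
    fix g A assume "\<exists>f\<in>DEe M E. AE x in M. x \<in> A \<longrightarrow> g x \<le> f x"
    from excessive_minimizer_exists[OF bounded this] obtain h where
      h: "excessive M E h" "h \<in> DEe M E" "AE x in M. x \<in> A \<longrightarrow> g x \<le> h x"
      and hmin: "\<And>f. f \<in> L0 M \<Longrightarrow> (AE x in M. x \<in> A \<longrightarrow> g x \<le> f x) \<Longrightarrow> Ee M E h \<le> Ee M E f"
      by blast
    have unique: "AE x in M. h' x = h x"
      if sc: "Ee_strictly_convex M E" and h': "h' \<in> DEe M E" "AE x in M. x \<in> A \<longrightarrow> g x \<le> h' x"
        and h'min: "\<forall>f\<in>L0 M. (AE x in M. x \<in> A \<longrightarrow> g x \<le> f x) \<longrightarrow> Ee M E h' \<le> Ee M E f" for h'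
    proof (rule ccontr)
      assume ne: "\<not> (AE x in M. h' x = h x)"
      \<comment> \<open>The obstacle condition is convex, so the midpoint of two minimisers is
        admissible, while strict convexity would put its energy below the common minimum.\<close>
      let ?m = "\<lambda>x. (h' x + h x) / 2"
      have mL: "?m \<in> L0 M" using h(2) h'(1) by (auto simp: DEe_def L0_def)
      have "AE x in M. x \<in> A \<longrightarrow> g x \<le> ?m x"
        using h(3) h'(2) by eventually_elim auto
      then have "Ee M E h \<le> Ee M E ?m" by (rule hmin[OF mL])
      also have "\<dots> < (Ee M E h' + Ee M E h) / 2"
        using sc h' h ne unfolding Ee_strictly_convex_def by blast
      also have "Ee M E h' = Ee M E h"
        using h h' hmin h'min by (intro antisym) (auto simp: DEe_def)
      finally have "Ee M E h < (Ee M E h + Ee M E h) / 2" .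
      moreover obtain r where "r \<ge> 0" "Ee M E h = ennreal r"
        using h(2) by (cases "Ee M E h") (auto simp: DEe_def)
      ultimately show False
        by (simp add: ennreal_plus[symmetric] ennreal_divide_numeral del: ennreal_plus)
    qed
    have banach: "Ee_exists M E \<and> (\<forall>f\<in>L0 M. Ee M E f = Ebar M E f) \<and> h \<in> L2 M \<and> E h < \<infinity>"
      if "lux_banach M E"
    proof -
      have "Ebar M E h < \<infinity>"
        using lux_banach_Ee_eq_Ebar[OF that, of h] h(2) by (simp add: DEe_def)
      then have "h \<in> L2 M" "E h < \<infinity>" by (auto simp: Ebar_def split: if_splits)
      then show ?thesis using lux_banach_Ee_exists[OF that] lux_banach_Ee_eq_Ebar[OF that] by blast
    qed
    show "\<exists>h. excessive M E h \<and> (\<forall>x. 0 \<le> h x) \<and> h \<in> DEe M E \<and>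
            (AE x in M. x \<in> A \<longrightarrow> g x \<le> h x) \<and>
            (\<forall>f\<in>L0 M. (AE x in M. x \<in> A \<longrightarrow> g x \<le> f x) \<longrightarrow> Ee M E h \<le> Ee M E f) \<and>
            (Ee_strictly_convex M E \<longrightarrow>
               (\<forall>h'. excessive M E h' \<and> (\<forall>x. 0 \<le> h' x) \<and> h' \<in> DEe M E \<and>
                  (AE x in M. x \<in> A \<longrightarrow> g x \<le> h' x) \<and>
                  (\<forall>f\<in>L0 M. (AE x in M. x \<in> A \<longrightarrow> g x \<le> f x) \<longrightarrow> Ee M E h' \<le> Ee M E f)
                  \<longrightarrow> (AE x in M. h' x = h x))) \<and>
            (lux_banach M E \<longrightarrow>
               Ee_exists M E \<and> (\<forall>f\<in>L0 M. Ee M E f = Ebar M E f) \<and>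
               h \<in> L2 M \<and> E h < \<infinity>)"
    proof (intro exI[of _ h] conjI)
      show "\<forall>x. 0 \<le> h x" using h(1) by (simp add: excessive_def)
    qed (use h hmin unique banach in blast)+
  next
    assume "\<exists>g\<in>DEe M E. AE x in M. 0 < g x"
    then show "\<exists>h. excessive M E h \<and> (\<forall>x. 0 < h x)"
      by (rule positive_excessive_exists[OF bounded])
  qed
qed

end
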